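(* The distribution of $(V^{(1)},V^{(2)})$ is operator stable, and the diagonal $2\times2$ matrix with diagonal entries $\frac{2}{\alpha}$ and $\frac{3}{2\alpha}$ (in this order) is an exponent of it. Particularly, the distribution of $(V^{(1)},V^{(2)})$ is full and infinitely divisible, and has an infinitely differentiable density function, and the partial derivatives of this density function tend to $0$ at infinity.
   Context: Parameters: $\alpha\in(1,2)$, $\mu_A\in(0,1)$, $\sigma_A^2\in(0,\infty)$, $\theta:=1-\mu_A^\alpha$. $(V^{(1)},V^{(2)})$ is a random vector with $$(V^{(1)},V^{(2)})\stackrel{d}{=}\biggl(\frac{1}{1-\mu_A^2}\sum_{i=1}^\infty P_i^2,\ \frac{1}{(1-\mu_A^3)^{1/2}}\sum_{i=1}^\infty P_i^{3/2}Z_i\biggr),$$ where $\sum_{i=1}^\infty\delta_{P_i}$ is a Poisson point process on $(0,\infty)$ with intensity $\theta\alpha y^{-\alpha-1}\,\mathrm{d}y$, with $P_1\ge P_2\ge\cdots$ almost surely, and $(Z_i)_{i\ge1}$ is an i.i.d. sequence of $\mathcal{N}(0,\sigma_A^2)$-distributed random variables independent of it; both series converge almost surely. Equivalently, its joint characteristic function is $$\mathbb{E}\bigl[\mathrm{e}^{\mathrm{i}(sV^{(1)}+tV^{(2)})}\bigr]=\exp\biggl\{\theta\int_0^\infty\biggl(\exp\biggl\{\frac{\mathrm{i}s}{1-\mu_A^2}y^2-\frac{\sigma_A^2t^2}{2(1-\mu_A^3)}y^3\biggr\}-1\biggr)\alpha y^{-\alpha-1}\,\mathrm{d}y\biggr\},\quad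 s,t\in\mathbb{R}.$$ A probability distribution on $\mathbb{R}^2$ is full if it is not concentrated on a proper affine subspace, i.e. if for a random vector $(\xi_1,\xi_2)$ with this distribution, $v_1\xi_1+v_2\xi_2$ is nondegenerate for every $(v_1,v_2)\neq(0,0)$. A full infinitely divisible distribution $\nu$ on $\mathbb{R}^2$ is operator stable with exponent $E\in\mathbb{R}^{2\times2}$ if for every $a>0$ there is $b_a\in\mathbb{R}^2$ such that the convolution power $\nu^{*a}$ (the distribution with characteristic function $\widehat{\nu}^{\,a}$) equals the distribution of $a^E\xi+b_a$, where $\xi$ has distribution $\nu$ and $a^E:=\exp(E\log a)$. *)

theory Defs
  imports "HOL-Probability.Probability"
begin

section \<open>Poisson point processes\<close>

text \<open>The measure \<open>\<Sum>\<^sub>i \<delta>\<^bsub>p i\<^esub>\<close> on the Borel sets, points counted with multiplicity.\<close>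

definition sum_of_diracs :: "(nat \<Rightarrow> real) \<Rightarrow> real measure" where
  "sum_of_diracs p = distr (count_space UNIV) borel p"

text \<open>A \<open>Poisson(\<lambda>)\<close> distributed count with values in \<open>[0,\<infinity>]\<close>, where \<open>Poisson(\<infinity>)\<close> is the point mass at \<open>\<infinity>\<close>.\<close>

definition poisson_distributed :: "'w measure \<Rightarrow> ennreal \<Rightarrow> ('w \<Rightarrow> ennreal) \<Rightarrow> bool" where
  "poisson_distributed M \<Lambda> X \<longleftrightarrow>
     X \<in> borel_measurable M \<and>
     (if \<Lambda> = \<infinity> then AE \<omega> in M. X \<omega> = \<infinity>
      else \<forall>k::nat. measure M {\<omega> \<in> space M. X \<omega> = of_nat k}
             = enn2real \<Lambda> ^ k / fact k * exp (- enn2real \<Lambda>))"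

definition poisson_point_process ::
  "'w measure \<Rightarrow> 'a measure \<Rightarrow> ('w \<Rightarrow> 'a measure) \<Rightarrow> bool" where
  "poisson_point_process M \<Lambda> \<xi> \<longleftrightarrow>
     (\<forall>\<omega>\<in>space M. sets (\<xi> \<omega>) = sets \<Lambda>) \<and>
     (\<forall>B\<in>sets \<Lambda>. poisson_distributed M (emeasure \<Lambda> B) (\<lambda>\<omega>. emeasure (\<xi> \<omega>) B)) \<and>
     (\<forall>(J::nat set) B. finite J \<longrightarrow> (\<forall>j\<in>J. B j \<in> sets \<Lambda>) \<longrightarrow> disjoint_family_on B J \<longrightarrow>
        prob_space.indep_vars M (\<lambda>_. borel) (\<lambda>j \<omega>. emeasure (\<xi> \<omega>) (B j)) J)"


section \<open>Full, infinitely divisible and operator stable distributions\<close>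

definition full_distribution :: "'a::euclidean_space measure \<Rightarrow> bool" where
  "full_distribution \<nu> \<longleftrightarrow> \<not> (\<exists>S. affine S \<and> S \<noteq> UNIV \<and> (AE x in \<nu>. x \<in> S))"

primrec convolution_power ::
  "'a::ordered_euclidean_space measure \<Rightarrow> nat \<Rightarrow> 'a measure" where
  "convolution_power \<rho> 0 = return borel 0"
| "convolution_power \<rho> (Suc n) = (\<rho> \<star> convolution_power \<rho> n)"

definition infinitely_divisible :: "'a::ordered_euclidean_space measure \<Rightarrow> bool" where
  "infinitely_divisible \<nu> \<longleftrightarrow>
     (\<forall>n>0. \<exists>\<rho>. prob_space \<rho> \<and> sets \<rho> = sets borel \<and> \<nu> = convolution_power \<rho> n)"

definition char_fun :: "'a::euclidean_space measure \<Rightarrow> 'a \<Rightarrow> complex" where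
  "char_fun \<nu> t = (CLINT x|\<nu>. iexp (t \<bullet> x))"

text \<open>
  The distribution \<open>\<rho>\<close> is the convolution power of \<open>\<nu>\<close> with real exponent \<open>a\<close>. As usual for
  infinitely divisible \<open>\<nu>\<close>, the power \<open>(char_fun \<nu>)\<^sup>a\<close> is formed with the distinguished logarithm
  \<open>\<psi>\<close> of \<open>char_fun \<nu>\<close>, i.e. the unique continuous one vanishing at \<open>0\<close>; the principal
  branch of the complex power would be wrong in general.
\<close>

definition is_real_convolution_power ::
  "'a::euclidean_space measure \<Rightarrow> real \<Rightarrow> 'a measure \<Rightarrow> bool" where
  "is_real_convolution_power \<nu> a \<rho> \<longleftrightarrow>
     prob_space \<rho> \<and> sets \<rho> = sets borel \<and>
     (\<exists>\<psi>. continuous_on UNIV \<psi> \<and> \<psi> 0 = 0 \<and>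
          (\<forall>t. char_fun \<nu> t = exp (\<psi> t)) \<and>
          (\<forall>t. char_fun \<rho> t = exp (of_real a * \<psi> t)))"

text \<open>The multiplication of the type class instance on vectors is componentwise, so the matrix
  exponential is not the library's \<open>exp\<close>.\<close>

definition matrix_exp :: "real^'n^'n \<Rightarrow> real^'n^'n" where
  "matrix_exp A = (\<Sum>k. (1 / fact k) *\<^sub>R (((**) A) ^^ k) (mat 1))"

definition matrix_powr :: "real \<Rightarrow> real^'n^'n \<Rightarrow> real^'n^'n" where
  "matrix_powr a E = matrix_exp (ln a *\<^sub>R E)"

definition operator_stable_exponent :: "(real^'n) measure \<Rightarrow> real^'n^'n \<Rightarrow> bool" where
  "operator_stable_exponent \<nu> E \<longleftrightarrow>
     prob_space \<nu> \<and> sets \<nu> = sets borel \<and> full_distribution \<nu> \<and> infinitely_divisible \<nu> \<and>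
     (\<forall>a>0. \<exists>b. is_real_convolution_power \<nu> a
                  (distr \<nu> borel (\<lambda>x. matrix_powr a E *v x + b)))"

definition operator_stable :: "(real^'n) measure \<Rightarrow> bool" where
  "operator_stable \<nu> \<longleftrightarrow> (\<exists>E. operator_stable_exponent \<nu> E)"


section \<open>Partial derivatives\<close>

definition partial_deriv :: "'n::finite \<Rightarrow> (real^'n \<Rightarrow> real) \<Rightarrow> real^'n \<Rightarrow> real" where
  "partial_deriv i f x = deriv (\<lambda>h. f (x + h *\<^sub>R axis i 1)) 0"

text \<open>The list gives the coordinates of the successive derivatives, the last entry being
  differentiated first.\<close>

definition iterated_partial_deriv :: "'n::finite list \<Rightarrow> (real^'n \<Rightarrow> real) \<Rightarrow> real^'n \<Rightarrow> real" where
  "iterated_partial_deriv is f = foldr partial_deriv is f"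

definition infinitely_differentiable :: "(real^'n::finite \<Rightarrow> real) \<Rightarrow> bool" where
  "infinitely_differentiable f \<longleftrightarrow>
     (\<forall>is x. iterated_partial_deriv is f differentiable (at x))"

end

theory Submission
  imports Defs
begin

text \<open>
  Conditioning on the points, the Gaussian marks integrate out and turn the joint characteristic
  function into the expectation of \<open>exp (\<Sum>\<^sub>i g (P\<^sub>i))\<close>, where
  \<open>g y = \<i> s y\<^sup>2 - b y\<^sup>3\<close> and \<open>b\<close> is proportional to \<open>t\<^sup>2\<close>. The exponential formula for Poisson
  processes (\<open>poisson_exponential_formula\<close>) evaluates this as \<open>exp (\<Psi> s b)\<close> with
  \<open>\<Psi> s b = \<integral> (exp (g y) - 1) \<Lambda>(dy)\<close>, where \<open>\<Lambda>\<close> is the intensity (\<open>char_fun_marked_series\<close>).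

  Everything else is read off from \<open>\<Psi>\<close>. The measure \<open>\<Lambda>\<close> is homogeneous of degree \<open>-\<alpha>\<close>, so that
  substituting \<open>y \<mapsto> l y\<close> gives \<open>\<Psi> (l\<^sup>2 s) (l\<^sup>3 b) = l\<^sup>\<alpha> \<Psi> s b\<close> (\<open>levy_exponent_scale\<close>). With
  \<open>l = a\<^sup>1\<^sup>/\<^sup>\<alpha>\<close> this says that the linear map with diagonal entries \<open>a\<^sup>2\<^sup>/\<^sup>\<alpha>\<close> and \<open>a\<^sup>3\<^sup>/\<^sup>2\<^sup>\<alpha>\<close> transports the
  distribution to its \<open>a\<close>-th convolution power, without any shift. For \<open>a = 1/n\<close> the image is an
  \<open>n\<close>-th convolution root, hence infinite divisibility.

  The same scaling, applied to one variable at a time, shows that \<open>-Re (\<Psi> s b)\<close> dominates a multiple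
  of \<open>\<bar>s\<bar>\<^sup>\<alpha>\<^sup>/\<^sup>2 + b\<^sup>\<alpha>\<^sup>/\<^sup>3\<close> (\<open>levy_exponent_lower_bound\<close>), so that the characteristic function decays
  faster than every power. By Fourier inversion on a Euclidean space
  (\<open>density_inv_fourier_char_fun\<close>, obtained by Gaussian smoothing) the distribution
  has a density which is the inverse Fourier transform of the characteristic function. It is smooth,
  it tends to \<open>0\<close> at infinity because it is integrable and Lipschitz continuous, and its derivatives
  inherit this from the bounds on the next derivative (\<open>inv_fourier_derivative_tendsto_0\<close>). A
  distribution with a density is full because proper affine subspaces are Lebesgue null sets.
\<close>

section \<open>Fourier transforms of Gaussian kernels\<close>

lemma
  fixes f :: "'a::euclidean_space \<Rightarrow> real \<Rightarrow> 'b::{real_normed_field,banach,second_countable_topology}"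
  assumes int: "\<And>b. b \<in> Basis \<Longrightarrow> integrable lborel (f b)"
  shows lborel_integrable_prod_Basis: "integrable lborel (\<lambda>x. \<Prod>b\<in>Basis. f b (x \<bullet> b))"
    and lborel_integral_prod_Basis:
      "(\<integral>x. (\<Prod>b\<in>Basis. f b (x \<bullet> b)) \<partial>lborel) = (\<Prod>b\<in>Basis. \<integral>x. f b x \<partial>lborel)"
proof -
  interpret product_sigma_finite "\<lambda>b::'a. lborel :: real measure" by standard
  have [measurable]: "\<And>b. b \<in> Basis \<Longrightarrow> f b \<in> borel_measurable borel"
    using int by (auto dest: borel_measurable_integrable)
  have T[measurable]: "(\<lambda>g. \<Sum>b\<in>Basis. g b *\<^sub>R b) \<in> (\<Pi>\<^sub>M b\<in>(Basis::'a set). lborel) \<rightarrow>\<^sub>M borel"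
    by measurable
  have M: "(\<lambda>x. \<Prod>b\<in>Basis. f b (x \<bullet> b)) \<in> borel_measurable borel"
    by measurable
  have eq: "(\<Prod>b\<in>Basis. f b ((\<Sum>c\<in>Basis. g c *\<^sub>R c) \<bullet> b)) = (\<Prod>b\<in>Basis. f b (g b))" for g
    by (intro prod.cong refl) simp
  show "integrable lborel (\<lambda>x. \<Prod>b\<in>Basis. f b (x \<bullet> b))"
    by (subst lborel_eq, subst integrable_distr_eq[OF T M], subst eq)
       (rule product_integrable_prod[OF finite_Basis int])
  show "(\<integral>x. (\<Prod>b\<in>Basis. f b (x \<bullet> b)) \<partial>lborel) = (\<Prod>b\<in>Basis. \<integral>x. f b x \<partial>lborel)"
    by (subst lborel_eq, subst integral_distr[OF T M], subst eq)
       (rule product_integral_prod[OF finite_Basis int])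
qed

lemma normal_density_fourier:
  assumes "0 < \<sigma>"
  shows "(CLINT x|lborel. of_real (normal_density 0 \<sigma> x) * iexp (t * x))
           = of_real (exp (- (\<sigma> * t)\<^sup>2 / 2))"
proof -
  have "(CLINT x|lborel. of_real (normal_density 0 \<sigma> x) * iexp (t * x))
      = \<bar>\<sigma>\<bar> *\<^sub>R (CLINT x|lborel. of_real (normal_density 0 \<sigma> (0 + \<sigma> * x)) * iexp (t * (0 + \<sigma> * x)))"
    by (rule lborel_integral_real_affine) (use assms in simp)
  also have "\<dots> = (CLINT x|lborel. \<sigma> *\<^sub>R (of_real (normal_density 0 \<sigma> (\<sigma> * x)) * iexp (t * (\<sigma> * x))))"
    using assms by (subst integral_scaleR_right) simp_all
  also have "\<dots> = (CLINT x|lborel. std_normal_density x *\<^sub>R iexp ((\<sigma> * t) * x))"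
    using assms
    by (intro Bochner_Integration.integral_cong)
       (auto simp: normal_density_def scaleR_conv_of_real power_mult_distrib real_sqrt_mult field_simps)
  also have "\<dots> = char std_normal_distribution (\<sigma> * t)"
    unfolding char_def by (subst integral_density) (auto simp: ac_simps)
  finally show ?thesis
    by (simp add: char_std_normal_distribution)
qed

definition gauss_kernel :: "real \<Rightarrow> 'a::euclidean_space \<Rightarrow> real" where
  "gauss_kernel \<epsilon> x = (\<Prod>b\<in>Basis. normal_density 0 \<epsilon> (x \<bullet> b))"

lemma borel_measurable_gauss_kernel[measurable]: "gauss_kernel \<epsilon> \<in> borel_measurable borel"
  unfolding gauss_kernel_def[abs_def] by measurable

lemma gauss_kernel_nonneg: "0 \<le> gauss_kernel \<epsilon> x"
  by (auto simp: gauss_kernel_def intro: prod_nonneg)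

lemma integrable_gauss_kernel: "0 < \<epsilon> \<Longrightarrow> integrable lborel (gauss_kernel \<epsilon> :: 'a::euclidean_space \<Rightarrow> real)"
  unfolding gauss_kernel_def[abs_def] by (intro lborel_integrable_prod_Basis) auto

lemma integral_gauss_kernel: "0 < \<epsilon> \<Longrightarrow> (\<integral>x. gauss_kernel \<epsilon> x \<partial>(lborel :: 'a::euclidean_space measure)) = 1"
  unfolding gauss_kernel_def[abs_def] by (subst lborel_integral_prod_Basis) auto

lemma gauss_kernel_uminus: "gauss_kernel \<epsilon> (- x) = gauss_kernel \<epsilon> x"
  by (simp add: gauss_kernel_def normal_density_def)

lemma gauss_kernel_scaleR:
  assumes "0 < \<epsilon>"
  shows "\<epsilon> ^ DIM('a) * gauss_kernel \<epsilon> (\<epsilon> *\<^sub>R x) = gauss_kernel 1 (x::'a::euclidean_space)"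
proof -
  have "\<epsilon> * normal_density 0 \<epsilon> (\<epsilon> * y) = normal_density 0 1 y" for y
    using assms by (simp add: normal_density_def power_mult_distrib real_sqrt_mult field_simps)
  moreover have "\<epsilon> ^ DIM('a) = (\<Prod>b\<in>(Basis::'a set). \<epsilon>)"
    by simp
  ultimately show ?thesis
    unfolding gauss_kernel_def inner_scaleR_left by (simp only: prod.distrib[symmetric])
qed

text \<open>The Fourier transform of \<open>gauss_kernel \<epsilon>\<close>. It converges to \<open>1\<close> as \<open>\<epsilon>\<close> tends to \<open>0\<close> and makes
  Fourier integrals absolutely convergent.\<close>

definition gauss_weight :: "real \<Rightarrow> 'a::euclidean_space \<Rightarrow> real" where
  "gauss_weight \<epsilon> w = exp (- (\<epsilon> * norm w)\<^sup>2 / 2)"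

lemma borel_measurable_gauss_weight[measurable]: "gauss_weight \<epsilon> \<in> borel_measurable borel"
  unfolding gauss_weight_def[abs_def] by measurable

lemma gauss_weight_eq_prod:
  assumes "0 < \<epsilon>"
  shows "gauss_weight \<epsilon> w = (\<Prod>b\<in>Basis. sqrt (2 * pi) / \<epsilon> * normal_density 0 (1 / \<epsilon>) (w \<bullet> b))"
proof -
  have "- (\<epsilon> * norm w)\<^sup>2 / 2 = (\<Sum>b\<in>Basis. - (\<epsilon> * (w \<bullet> b))\<^sup>2 / 2)"
    unfolding power_mult_distrib power2_norm_eq_inner
    by (subst euclidean_inner) (simp add: sum_distrib_left sum_divide_distrib sum_negf power2_eq_square)
  moreover have "sqrt (2 * pi) / \<epsilon> * normal_density 0 (1 / \<epsilon>) y = exp (- (\<epsilon> * y)\<^sup>2 / 2)" for y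
    using assms by (simp add: normal_density_def real_sqrt_divide real_sqrt_mult field_simps)
  ultimately show ?thesis
    by (simp add: gauss_weight_def exp_sum)
qed

lemma integrable_gauss_weight: "0 < \<epsilon> \<Longrightarrow> integrable lborel (gauss_weight \<epsilon> :: 'a::euclidean_space \<Rightarrow> real)"
  by (subst gauss_weight_eq_prod[THEN ext], assumption, rule lborel_integrable_prod_Basis) auto

text \<open>Both sides factorize over the coordinates, so that this is the one-dimensional formula for a
  normal distribution with standard deviation \<open>1/\<epsilon>\<close>.\<close>

lemma gauss_weight_fourier:
  assumes "0 < \<epsilon>"
  shows "(CLINT w|lborel. of_real (gauss_weight \<epsilon> w) * iexp (w \<bullet> x))
           = of_real ((2 * pi) ^ DIM('a) * gauss_kernel \<epsilon> (x::'a::euclidean_space))"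
proof -
  let ?f = "\<lambda>b y. of_real (sqrt (2 * pi) / \<epsilon>) * (of_real (normal_density 0 (1 / \<epsilon>) y) * iexp ((x \<bullet> b) * y))"
  have int: "integrable lborel (?f b)" for b
  proof -
    have "integrable lborel (\<lambda>y. of_real (normal_density 0 (1 / \<epsilon>) y) * iexp ((x \<bullet> b) * y))"
      using assms by (intro Bochner_Integration.integrable_bound[OF integrable_normal_density[of "1/\<epsilon>" 0]])
        (auto simp: norm_mult)
    then show ?thesis by (rule integrable_mult_right)
  qed
  have "iexp (w \<bullet> x) = (\<Prod>b\<in>Basis. iexp ((x \<bullet> b) * (w \<bullet> b)))" for w
    by (subst euclidean_inner) (simp add: exp_sum sum_distrib_left mult_ac)
  then have "(CLINT w|lborel. of_real (gauss_weight \<epsilon> w) * iexp (w \<bullet> x)) = (CLINT w|lborel. (\<Prod>b\<in>Basis. ?f b (w \<bullet> b)))"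
    using assms
    by (intro Bochner_Integration.integral_cong refl)
       (simp only: gauss_weight_eq_prod of_real_prod prod.distrib[symmetric] of_real_mult mult.assoc)
  also have "\<dots> = (\<Prod>b\<in>Basis. \<integral>y. ?f b y \<partial>lborel)"
    by (rule lborel_integral_prod_Basis[OF int])
  also have "\<dots> = (\<Prod>b\<in>Basis. of_real (2 * pi * normal_density 0 \<epsilon> (x \<bullet> b)))"
  proof (intro prod.cong refl)
    fix b :: 'a
    have "sqrt (2 * pi) / \<epsilon> * exp (- (1 / \<epsilon> * (x \<bullet> b))\<^sup>2 / 2) = 2 * pi * normal_density 0 \<epsilon> (x \<bullet> b)"
      using assms by (simp add: normal_density_def real_sqrt_mult field_simps)
    then show "(\<integral>y. ?f b y \<partial>lborel) = of_real (2 * pi * normal_density 0 \<epsilon> (x \<bullet> b))"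
      using assms
      by (simp only: integral_mult_right_zero normal_density_fourier zero_less_divide_1_iff of_real_mult[symmetric])
  qed
  finally show ?thesis
    by (simp add: gauss_kernel_def prod.distrib)
qed

section \<open>Fourier inversion on Euclidean spaces\<close>

lemma borel_measurable_char_fun:
  assumes "prob_space \<nu>" and [measurable_cong]: "sets \<nu> = sets borel"
  shows "char_fun \<nu> \<in> borel_measurable borel"
proof -
  interpret prob_space \<nu> by fact
  show ?thesis
    unfolding char_fun_def[abs_def] by measurable
qed

text \<open>The sign and the factor are those of the inversion formula, so that an integrable characteristic
  function is mapped to the density itself.\<close>

definition inv_fourier :: "('a::euclidean_space \<Rightarrow> complex) \<Rightarrow> 'a \<Rightarrow> complex" where
  "inv_fourier h y = (CLINT w|lborel. iexp (- (w \<bullet> y)) * h w) / (2 * pi) ^ DIM('a)"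

lemma borel_measurable_inv_fourier[measurable]:
  assumes [measurable]: "h \<in> borel_measurable borel"
  shows "inv_fourier h \<in> borel_measurable borel"
  unfolding inv_fourier_def[abs_def] by measurable

lemma integrable_iexp_mult:
  fixes h :: "'a::euclidean_space \<Rightarrow> complex"
  assumes "integrable lborel h"
  shows "integrable lborel (\<lambda>w. iexp (- (w \<bullet> y)) * h w)"
proof -
  have [measurable]: "h \<in> borel_measurable borel"
    using assms by (auto dest: borel_measurable_integrable)
  show ?thesis
    by (rule Bochner_Integration.integrable_bound[OF assms]) (auto simp: norm_mult)
qed

lemma cmod_inv_fourier_le:
  fixes h :: "'a::euclidean_space \<Rightarrow> complex"
  assumes "integrable lborel h"
  shows "cmod (inv_fourier h y) \<le> (\<integral>w. cmod (h w) \<partial>lborel) / (2 * pi) ^ DIM('a)"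
proof -
  have "cmod (CLINT w|lborel. iexp (- (w \<bullet> y)) * h w) \<le> (\<integral>w. cmod (iexp (- (w \<bullet> y)) * h w) \<partial>lborel)"
    by (rule integral_norm_bound)
  also have "\<dots> = (\<integral>w. cmod (h w) \<partial>lborel)"
    by (simp add: norm_mult)
  finally show ?thesis
    by (simp add: inv_fourier_def norm_divide norm_mult norm_power divide_right_mono)
qed

text \<open>The inversion formula for the convolution of \<open>\<nu>\<close> with a Gaussian: the Gaussian weight makes the
  double integral absolutely convergent, so that Fubini's theorem applies, and the inner integral
  is the transform computed in \<open>gauss_weight_fourier\<close>.\<close>

lemma gauss_smoothing:
  fixes \<nu> :: "'a::euclidean_space measure"
  assumes "prob_space \<nu>" and S[measurable_cong]: "sets \<nu> = sets borel" and "0 < \<epsilon>"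
  shows "of_real (\<integral>x. gauss_kernel \<epsilon> (x - y) \<partial>\<nu>)
           = inv_fourier (\<lambda>w. of_real (gauss_weight \<epsilon> w) * char_fun \<nu> w) y"
proof -
  interpret prob_space \<nu> by fact
  interpret pair_sigma_finite \<nu> "lborel :: 'a measure" by standard
  let ?F = "\<lambda>x w. of_real (gauss_weight \<epsilon> w) * iexp (w \<bullet> (x - y)) :: complex"
  have 1: "integrable lborel (?F x)" for x
    by (rule Bochner_Integration.integrable_bound[OF integrable_gauss_weight[OF \<open>0 < \<epsilon>\<close>]])
       (auto simp: norm_mult)
  have int: "integrable (\<nu> \<Otimes>\<^sub>M lborel) (case_prod ?F)"
    by (rule Fubini_integrable) (auto simp: norm_mult 1)
  have "(CLINT w|lborel. iexp (- (w \<bullet> y)) * (of_real (gauss_weight \<epsilon> w) * char_fun \<nu> w))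
      = (CLINT w|lborel. CLINT x|\<nu>. ?F x w)"
    by (intro Bochner_Integration.integral_cong refl)
       (auto simp: char_fun_def integral_mult_right_zero[symmetric] inner_diff_right exp_diff exp_minus field_simps
         simp del: integral_mult_right_zero)
  also have "\<dots> = (CLINT x|\<nu>. CLINT w|lborel. ?F x w)"
    by (rule Fubini_integral[OF int])
  also have "\<dots> = (CLINT x|\<nu>. of_real ((2 * pi) ^ DIM('a) * gauss_kernel \<epsilon> (x - y)))"
    by (simp only: gauss_weight_fourier[OF \<open>0 < \<epsilon>\<close>])
  also have "\<dots> = of_real ((2 * pi) ^ DIM('a) * (\<integral>x. gauss_kernel \<epsilon> (x - y) \<partial>\<nu>))"
    by (simp only: integral_complex_of_real) simp
  finally show ?thesis
    by (simp add: inv_fourier_def)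
qed

lemma gauss_smoothing_tendsto:
  fixes \<phi> :: "'a::euclidean_space \<Rightarrow> complex"
  assumes "integrable lborel \<phi>"
  shows "(\<lambda>n. inv_fourier (\<lambda>w. of_real (gauss_weight (1 / Suc n) w) * \<phi> w) y) \<longlonglongrightarrow> inv_fourier \<phi> y"
proof -
  have [measurable]: "\<phi> \<in> borel_measurable borel"
    using assms by (auto dest: borel_measurable_integrable)
  have "(\<lambda>n. CLINT w|lborel. iexp (- (w \<bullet> y)) * (of_real (gauss_weight (1 / Suc n) w) * \<phi> w))
      \<longlonglongrightarrow> (CLINT w|lborel. iexp (- (w \<bullet> y)) * \<phi> w)"
  proof (rule integral_dominated_convergence[where w="\<lambda>w. cmod (\<phi> w)"])
    show "integrable lborel (\<lambda>w. cmod (\<phi> w))" using assms by (rule integrable_norm)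
    show "AE w in lborel. (\<lambda>n. iexp (- (w \<bullet> y)) * (of_real (gauss_weight (1 / Suc n) w) * \<phi> w))
            \<longlonglongrightarrow> iexp (- (w \<bullet> y)) * \<phi> w"
    proof (intro AE_I2)
      fix w :: 'a
      have "(\<lambda>n. 1 / real (Suc n)) \<longlonglongrightarrow> 0" by (rule LIMSEQ_Suc[OF lim_1_over_n])
      then have "(\<lambda>n. gauss_weight (1 / Suc n) w) \<longlonglongrightarrow> exp (- (0 * norm w)\<^sup>2 / 2)"
        unfolding gauss_weight_def by (intro tendsto_intros) auto
      then have "(\<lambda>n. iexp (- (w \<bullet> y)) * (of_real (gauss_weight (1 / Suc n) w) * \<phi> w))
            \<longlonglongrightarrow> iexp (- (w \<bullet> y)) * (of_real (exp (- (0 * norm w)\<^sup>2 / 2)) * \<phi> w)"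
        by (intro tendsto_intros)
      then show "(\<lambda>n. iexp (- (w \<bullet> y)) * (of_real (gauss_weight (1 / Suc n) w) * \<phi> w))
            \<longlonglongrightarrow> iexp (- (w \<bullet> y)) * \<phi> w" by simp
    qed
    show "AE w in lborel. norm (iexp (- (w \<bullet> y)) * (of_real (gauss_weight (1 / Suc n) w) * \<phi> w)) \<le> cmod (\<phi> w)" for n
      by (auto simp: norm_mult gauss_weight_def intro!: mult_left_le_one_le)
  qed measurable
  then show ?thesis
    unfolding inv_fourier_def by (intro tendsto_divide tendsto_const) simp_all
qed

text \<open>After the substitution \<open>y = x - \<epsilon> z\<close> the kernel no longer depends on \<open>\<epsilon>\<close> and dominated convergence
  applies.\<close>

lemma gauss_approximate_identity:
  fixes g :: "'a::euclidean_space \<Rightarrow> real"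
  assumes cont: "continuous_on UNIV g" and bdd: "\<And>x. \<bar>g x\<bar> \<le> B"
  shows "(\<lambda>n. \<integral>y. g y * gauss_kernel (1 / Suc n) (x - y) \<partial>lborel) \<longlonglongrightarrow> g x"
proof -
  have [measurable]: "g \<in> borel_measurable borel"
    using cont by (rule borel_measurable_continuous_onI)
  have *: "(\<integral>y. g y * gauss_kernel \<epsilon> (x - y) \<partial>lborel) = (\<integral>z. g (x + - \<epsilon> *\<^sub>R z) * gauss_kernel 1 z \<partial>lborel)"
    if "0 < \<epsilon>" for \<epsilon>
  proof -
    have "(\<integral>y. g y * gauss_kernel \<epsilon> (x - y) \<partial>lborel)
        = (\<integral>y. g y * gauss_kernel \<epsilon> (x - y) \<partial>density (distr lborel borel (\<lambda>z. x + - \<epsilon> *\<^sub>R z)) (\<lambda>_. ennreal (\<bar>-\<epsilon>\<bar> ^ DIM('a))))"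
      by (subst lborel_affine[of "- \<epsilon>" x]) (use that in auto)
    also have "\<dots> = (\<integral>z. \<epsilon> ^ DIM('a) * (g (x + - \<epsilon> *\<^sub>R z) * gauss_kernel \<epsilon> (\<epsilon> *\<^sub>R z)) \<partial>lborel)"
      using that by (subst integral_density) (auto simp: integral_distr)
    also have "\<dots> = (\<integral>z. g (x + - \<epsilon> *\<^sub>R z) * gauss_kernel 1 z \<partial>lborel)"
      using that by (simp add: gauss_kernel_scaleR[symmetric] mult_ac)
    finally show ?thesis .
  qed
  have "(\<lambda>n. \<integral>z. g (x + - (1 / Suc n) *\<^sub>R z) * gauss_kernel 1 z \<partial>lborel) \<longlonglongrightarrow> (\<integral>z. g x * gauss_kernel 1 z \<partial>(lborel::'a measure))"
  proof (rule integral_dominated_convergence[where w="\<lambda>z. B * gauss_kernel 1 z"])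
    show "integrable lborel (\<lambda>z::'a. B * gauss_kernel 1 z)"
      by (intro integrable_mult_right integrable_gauss_kernel) simp
    show "AE z in lborel. (\<lambda>n. g (x + - (1 / real (Suc n)) *\<^sub>R z) * gauss_kernel 1 z) \<longlonglongrightarrow> g x * gauss_kernel 1 z"
    proof (intro AE_I2 tendsto_mult tendsto_const)
      fix z :: 'a
      have "(\<lambda>n. 1 / real (Suc n)) \<longlonglongrightarrow> 0" by (rule LIMSEQ_Suc[OF lim_1_over_n])
      then have "(\<lambda>n. x + - (1 / real (Suc n)) *\<^sub>R z) \<longlonglongrightarrow> x + - 0 *\<^sub>R z"
        by (intro tendsto_intros)
      then show "(\<lambda>n. g (x + - (1 / real (Suc n)) *\<^sub>R z)) \<longlonglongrightarrow> g x"
        using cont by (intro isCont_tendsto_compose[of x g]) (auto simp: continuous_on_eq_continuous_at)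
    qed
    show "AE z in lborel. norm (g (x + - (1 / real (Suc n)) *\<^sub>R z) * gauss_kernel 1 z) \<le> B * gauss_kernel 1 z" for n
      using bdd by (auto simp: abs_mult gauss_kernel_nonneg intro!: mult_right_mono)
  qed measurable
  then show ?thesis
    by (subst *) (simp_all add: integral_gauss_kernel)
qed

lemma measure_eq_density_of_box:
  fixes \<nu> :: "'a::euclidean_space measure" and f :: "'a \<Rightarrow> real"
  assumes "prob_space \<nu>" and S: "sets \<nu> = sets borel" and f[measurable]: "f \<in> borel_measurable borel"
    and box: "\<And>a b. emeasure \<nu> (box a b) = (\<integral>\<^sup>+x. ennreal (f x) * indicator (box a b) x \<partial>lborel)"
  shows "\<nu> = density lborel (\<lambda>x. ennreal (f x))"
proof (rule measure_eqI_generator_eq)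
  interpret prob_space \<nu> by fact
  let ?E = "range (\<lambda>(a, b). box a b::'a set)"
  show "Int_stable ?E"
    by (auto simp: Int_stable_def box_Int_box)
  show "?E \<subseteq> Pow UNIV" "sets \<nu> = sigma_sets UNIV ?E"
    "sets (density lborel (\<lambda>x. ennreal (f x))) = sigma_sets UNIV ?E"
    by (simp_all add: borel_eq_box S)
  let ?A = "\<lambda>n::nat. box (- (real n *\<^sub>R One)) (real n *\<^sub>R One) :: 'a set"
  show "range ?A \<subseteq> ?E" "(\<Union>i. ?A i) = UNIV"
    unfolding UN_box_eq_UNIV by auto
  show "emeasure \<nu> (?A i) \<noteq> \<infinity>" for i by simp
  show "emeasure \<nu> X = emeasure (density lborel (\<lambda>x. ennreal (f x))) X" if "X \<in> ?E" for X
    using that by (auto simp: emeasure_density box)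
qed

lemma indicator_open_approx:
  fixes U :: "'a::euclidean_space set"
  assumes "open U" "U \<noteq> UNIV"
  obtains g :: "nat \<Rightarrow> 'a \<Rightarrow> real" where
    "\<And>k. continuous_on UNIV (g k)" "\<And>k x. \<bar>g k x\<bar> \<le> indicator U x"
    "\<And>x. (\<lambda>k. g k x) \<longlonglongrightarrow> indicator U x"
proof
  let ?g = "\<lambda>k x. min 1 (real k * infdist x (- U))"
  show "continuous_on UNIV (?g k)" for k
    by (intro continuous_intros)
  have out: "infdist x (- U) = 0" if "x \<notin> U" for x
    using that by (simp add: infdist_zero)
  then show "\<bar>?g k x\<bar> \<le> indicator U x" for k x
    by (auto simp: indicator_def infdist_nonneg)
  show "(\<lambda>k. ?g k x) \<longlonglongrightarrow> indicator U x" for x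
  proof (cases "x \<in> U")
    case True
    then have pos: "infdist x (- U) > 0"
      using assms by (intro infdist_pos_not_in_closed) auto
    obtain N :: nat where N: "1 / infdist x (- U) \<le> real N"
      using real_arch_simple by blast
    have "\<forall>\<^sub>F k in sequentially. ?g k x = 1"
      using eventually_ge_at_top[of N]
    proof eventually_elim
      case (elim k)
      then have "1 / infdist x (- U) \<le> real k" using N by linarith
      then have "1 \<le> real k * infdist x (- U)" using pos by (simp add: field_simps)
      then show ?case by simp
    qed
    then show ?thesis using True by (simp add: tendsto_eventually)
  next
    case False
    then show ?thesis by (simp add: out)
  qed
qed

text \<open>Inversion in weak form. The integral of \<open>g\<close> against the Gaussian smoothing of \<open>\<nu>\<close> has two limits as
  the smoothing vanishes: smoothing \<open>g\<close> instead of \<open>\<nu>\<close> gives the left-hand side, and inserting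
  \<open>gauss_smoothing\<close> gives the right-hand side.\<close>

lemma char_fun_inversion_test:
  fixes \<nu> :: "'a::euclidean_space measure" and g :: "'a \<Rightarrow> real"
  assumes \<nu>: "prob_space \<nu>" and S[measurable_cong]: "sets \<nu> = sets borel"
    and int: "integrable lborel (char_fun \<nu>)"
    and cont: "continuous_on UNIV g" and bdd: "\<And>x. \<bar>g x\<bar> \<le> B" and gint: "integrable lborel g"
  shows "(\<integral>x. g x \<partial>\<nu>) = (\<integral>y. g y * Re (inv_fourier (char_fun \<nu>) y) \<partial>lborel)"
proof -
  interpret prob_space \<nu> by fact
  interpret P: pair_sigma_finite "lborel :: 'a measure" \<nu> by standard
  let ?K = "\<lambda>n. gauss_kernel (1 / real (Suc n)) :: 'a \<Rightarrow> real"
  let ?k = "\<lambda>n y. \<integral>x. ?K n (x - y) \<partial>\<nu>"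
  define C where "C = (\<integral>w. cmod (char_fun \<nu> w) \<partial>lborel) / (2 * pi) ^ DIM('a)"
  have [measurable]: "g \<in> borel_measurable borel"
    using cont by (rule borel_measurable_continuous_onI)
  have [measurable]: "char_fun \<nu> \<in> borel_measurable borel"
    using \<nu> S by (rule borel_measurable_char_fun)
  have k_eq: "complex_of_real (?k n y) = inv_fourier (\<lambda>w. of_real (gauss_weight (1 / Suc n) w) * char_fun \<nu> w) y" for n y
    by (rule gauss_smoothing[OF \<nu> S]) simp
  have k_nonneg: "0 \<le> ?k n y" for n y
    by (intro integral_nonneg_AE) (simp add: gauss_kernel_nonneg)
  have k_le: "?k n y \<le> C" for n y
  proof -
    have "\<bar>?k n y\<bar> = cmod (inv_fourier (\<lambda>w. of_real (gauss_weight (1 / Suc n) w) * char_fun \<nu> w) y)"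
      by (simp only: k_eq[symmetric] norm_of_real)
    also have "\<dots> \<le> (\<integral>w. cmod (of_real (gauss_weight (1 / Suc n) w) * char_fun \<nu> w) \<partial>lborel) / (2 * pi) ^ DIM('a)"
      by (intro cmod_inv_fourier_le Bochner_Integration.integrable_bound[OF int])
         (auto simp: norm_mult gauss_weight_def intro!: mult_left_le_one_le)
    also have "\<dots> \<le> C"
      unfolding C_def
      by (intro divide_right_mono integral_mono Bochner_Integration.integrable_bound[OF int] integrable_norm int)
         (auto simp: norm_mult gauss_weight_def intro!: mult_left_le_one_le)
    finally show ?thesis by simp
  qed
  have k_lim: "(\<lambda>n. ?k n y) \<longlonglongrightarrow> Re (inv_fourier (char_fun \<nu>) y)" for y
    using tendsto_Re[OF gauss_smoothing_tendsto[OF int, of y]] by (simp only: k_eq[symmetric] Re_complex_of_real)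
  have lim1: "(\<lambda>n. \<integral>y. g y * ?k n y \<partial>lborel) \<longlonglongrightarrow> (\<integral>y. g y * Re (inv_fourier (char_fun \<nu>) y) \<partial>lborel)"
  proof (rule integral_dominated_convergence[where w="\<lambda>y. \<bar>g y\<bar> * C"])
    show "integrable lborel (\<lambda>y. \<bar>g y\<bar> * C)"
      using gint by auto
    show "AE y in lborel. (\<lambda>n. g y * ?k n y) \<longlonglongrightarrow> g y * Re (inv_fourier (char_fun \<nu>) y)"
      by (intro AE_I2 tendsto_intros k_lim)
    show "AE y in lborel. norm (g y * ?k n y) \<le> \<bar>g y\<bar> * C" for n
      using k_le[of n] k_nonneg[of n] by (intro AE_I2) (auto simp: abs_mult intro!: mult_left_mono)
  qed measurable
  \<comment> \<open>Fubini: the smoothing is moved from the measure to the test function.\<close>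
  have swap: "(\<integral>y. g y * ?k n y \<partial>lborel) = (\<integral>x. (\<integral>y. g y * ?K n (x - y) \<partial>lborel) \<partial>\<nu>)" for n
  proof -
    obtain D where D: "\<And>z::'a. ?K n z \<le> D"
    proof
      fix z :: 'a
      have "normal_density 0 (1 / real (Suc n)) t \<le> normal_density 0 (1 / real (Suc n)) 0" for t
        by (auto simp: normal_density_def intro!: divide_right_mono)
      then show "?K n z \<le> (\<Prod>b\<in>(Basis::'a set). normal_density 0 (1 / real (Suc n)) 0)"
        unfolding gauss_kernel_def by (intro prod_mono) auto
    qed
    have Kint: "integrable \<nu> (\<lambda>x. ?K n (x - y))" for y
      by (rule integrable_const_bound[where B=D]) (use D in \<open>auto simp: gauss_kernel_nonneg\<close>)
    have "integrable (lborel \<Otimes>\<^sub>M \<nu>) (\<lambda>(y, x). g y * ?K n (x - y))"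
    proof (rule P.Fubini_integrable)
      have "integrable lborel (\<lambda>y. \<bar>g y\<bar> * ?k n y)"
      proof (rule Bochner_Integration.integrable_bound[where f="\<lambda>y. \<bar>g y\<bar> * C"])
        have "0 \<le> C" using order.trans[OF k_nonneg k_le] .
        then show "AE y in lborel. norm (\<bar>g y\<bar> * ?k n y) \<le> norm (\<bar>g y\<bar> * C)"
          using k_le[of n] k_nonneg[of n] by (intro AE_I2) (auto simp: abs_mult intro!: mult_left_mono)
      qed (use gint in auto)
      then show "integrable lborel (\<lambda>y. \<integral>x. norm (case (y, x) of (y, x) \<Rightarrow> g y * ?K n (x - y)) \<partial>\<nu>)"
        by (simp add: abs_mult gauss_kernel_nonneg)
    qed (use Kint in \<open>auto intro!: AE_I2\<close>)
    then have "(\<integral>x. (\<integral>y. g y * ?K n (x - y) \<partial>lborel) \<partial>\<nu>) = (\<integral>y. (\<integral>x. g y * ?K n (x - y) \<partial>\<nu>) \<partial>lborel)"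
      by (rule P.Fubini_integral)
    then show ?thesis by simp
  qed
  have lim2: "(\<lambda>n. \<integral>x. (\<integral>y. g y * ?K n (x - y) \<partial>lborel) \<partial>\<nu>) \<longlonglongrightarrow> (\<integral>x. g x \<partial>\<nu>)"
  proof (rule integral_dominated_convergence[where w="\<lambda>x. B"])
    show "AE x in \<nu>. (\<lambda>n. \<integral>y. g y * ?K n (x - y) \<partial>lborel) \<longlonglongrightarrow> g x"
      by (intro AE_I2 gauss_approximate_identity[OF cont bdd])
    show "AE x in \<nu>. norm (\<integral>y. g y * ?K n (x - y) \<partial>lborel) \<le> B" for n
    proof (intro AE_I2)
      fix x :: 'a
      have i: "integrable lborel (\<lambda>y. ?K n (x - y))"
      proof -
        have "integrable (distr lborel borel ((+) (- x))) (?K n)"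
          by (subst lborel_distr_plus) (simp add: integrable_gauss_kernel)
        then show ?thesis
          by (subst (asm) integrable_distr_eq) (auto simp: gauss_kernel_uminus[of _ "x - _", symmetric])
      qed
      have e: "(\<integral>y. ?K n (x - y) \<partial>lborel) = 1"
      proof -
        have "(\<integral>y. ?K n y \<partial>distr lborel borel ((+) (- x))) = 1"
          by (subst lborel_distr_plus) (simp add: integral_gauss_kernel)
        then show ?thesis
          by (subst (asm) integral_distr) (auto simp: gauss_kernel_uminus[of _ "x - _", symmetric])
      qed
      have le: "norm (g y * ?K n (x - y)) \<le> B * ?K n (x - y)" for y
        unfolding real_norm_def abs_mult abs_of_nonneg[OF gauss_kernel_nonneg]
        by (intro mult_right_mono bdd gauss_kernel_nonneg)
      have Bi: "integrable lborel (\<lambda>y. B * ?K n (x - y))"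
        using i by (rule integrable_mult_right)
      have "norm (\<integral>y. g y * ?K n (x - y) \<partial>lborel) \<le> (\<integral>y. B * ?K n (x - y) \<partial>lborel)"
      proof (rule Bochner_Integration.integral_norm_bound_integral[OF _ Bi le])
        show "integrable lborel (\<lambda>y. g y * ?K n (x - y))"
          by (rule Bochner_Integration.integrable_bound[OF Bi])
             (measurable, intro AE_I2, metis le real_norm_def abs_ge_self order.trans)
      qed
      also have "\<dots> = B" by (simp only: integral_mult_right_zero e mult_1_right)
      finally show "norm (\<integral>y. g y * ?K n (x - y) \<partial>lborel) \<le> B" .
    qed
  qed auto
  show ?thesis
    using LIMSEQ_unique[OF lim2[folded swap] lim1] .
qed

text \<open>The transform is a pointwise limit of the densities of the smoothed measures, which are nonnegative.\<close>

lemma Re_inv_fourier_char_fun_nonneg: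
  fixes \<nu> :: "'a::euclidean_space measure"
  assumes \<nu>: "prob_space \<nu>" and S: "sets \<nu> = sets borel"
    and int: "integrable lborel (char_fun \<nu>)"
  shows "0 \<le> Re (inv_fourier (char_fun \<nu>) y)"
proof -
  have "(\<lambda>n. inv_fourier (\<lambda>w. of_real (gauss_weight (1 / Suc n) w) * char_fun \<nu> w) y) \<longlonglongrightarrow> inv_fourier (char_fun \<nu>) y"
    by (rule gauss_smoothing_tendsto[OF int])
  then have "(\<lambda>n. Re (inv_fourier (\<lambda>w. of_real (gauss_weight (1 / Suc n) w) * char_fun \<nu> w) y)) \<longlonglongrightarrow> Re (inv_fourier (char_fun \<nu>) y)"
    by (rule tendsto_Re)
  moreover have "0 \<le> Re (inv_fourier (\<lambda>w. of_real (gauss_weight (1 / Suc n) w) * char_fun \<nu> w) y)" for n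
    by (subst gauss_smoothing[OF \<nu> S, symmetric]) (auto intro!: integral_nonneg_AE simp: gauss_kernel_nonneg)
  ultimately show ?thesis
    by (intro LIMSEQ_le_const) auto
qed

text \<open>Both measures agree on boxes, whose indicators are limits of the continuous functions allowed in
  \<open>char_fun_inversion_test\<close>.\<close>

theorem density_inv_fourier_char_fun:
  fixes \<nu> :: "'a::euclidean_space measure"
  assumes \<nu>: "prob_space \<nu>" and S[measurable_cong]: "sets \<nu> = sets borel"
    and int: "integrable lborel (char_fun \<nu>)"
  shows "\<nu> = density lborel (\<lambda>y. ennreal (Re (inv_fourier (char_fun \<nu>) y)))"
proof (rule measure_eq_density_of_box[OF \<nu> S])
  interpret prob_space \<nu> by fact
  have [measurable]: "char_fun \<nu> \<in> borel_measurable borel"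
    using \<nu> S by (rule borel_measurable_char_fun)
  show "(\<lambda>y. Re (inv_fourier (char_fun \<nu>) y)) \<in> borel_measurable borel"
    by measurable
  let ?f = "\<lambda>y. Re (inv_fourier (char_fun \<nu>) y)"
  define C where "C = (\<integral>w. cmod (char_fun \<nu> w) \<partial>lborel) / (2 * pi) ^ DIM('a)"
  have fC: "\<bar>?f y\<bar> \<le> C" for y
    unfolding C_def by (rule order.trans[OF abs_Re_le_cmod cmod_inv_fourier_le[OF int]])
  fix a b :: 'a
  let ?U = "box a b"
  have Uint: "integrable lborel (indicator ?U :: 'a \<Rightarrow> real)"
    by (rule integrable_real_indicator[OF _ emeasure_lborel_box_finite]) simp
  have "?U \<noteq> UNIV"
    using bounded_box[of a b] not_bounded_UNIV by metis
  then obtain g :: "nat \<Rightarrow> 'a \<Rightarrow> real" where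
    g: "\<And>k. continuous_on UNIV (g k)" "\<And>k x. \<bar>g k x\<bar> \<le> indicator ?U x" "\<And>x. (\<lambda>k. g k x) \<longlonglongrightarrow> indicator ?U x"
    using indicator_open_approx[OF open_box] by blast
  have [measurable]: "g k \<in> borel_measurable borel" for k
    using g(1) by (rule borel_measurable_continuous_onI)
  have eq: "(\<integral>x. g k x \<partial>\<nu>) = (\<integral>y. g k y * ?f y \<partial>lborel)" for k
  proof (rule char_fun_inversion_test[OF \<nu> S int g(1)])
    show "\<bar>g k x\<bar> \<le> 1" for x
      using g(2)[of k x] indicator_le_1[of ?U x] by (rule order.trans)
    show "integrable lborel (g k)"
      by (rule Bochner_Integration.integrable_bound[OF Uint]) (use g(2) in auto)
  qed
  have 1: "(\<lambda>k. \<integral>x. g k x \<partial>\<nu>) \<longlonglongrightarrow> (\<integral>x. indicator ?U x \<partial>\<nu>)"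
    by (rule integral_dominated_convergence[where w="indicator ?U"])
       (use g(2,3) in \<open>auto simp: less_top[symmetric]\<close>)
  have fint: "integrable lborel (\<lambda>y. indicator ?U y * C)"
    using Uint by (rule integrable_mult_left)
  have 2: "(\<lambda>k. \<integral>y. g k y * ?f y \<partial>lborel) \<longlonglongrightarrow> (\<integral>y. indicator ?U y * ?f y \<partial>lborel)"
  proof (rule integral_dominated_convergence[OF _ _ fint])
    show "AE y in lborel. norm (g k y * ?f y) \<le> indicator ?U y * C" for k
      using g(2) fC by (auto simp: abs_mult intro!: mult_mono)
  qed (use g(3) in \<open>auto intro!: tendsto_intros\<close>)
  have I: "integrable lborel (\<lambda>y. indicator ?U y * ?f y)"
    by (rule Bochner_Integration.integrable_bound[OF fint])
       (use fC in \<open>auto simp: abs_mult intro!: mult_left_mono order.trans[OF _ abs_ge_self]\<close>)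
  have "measure \<nu> ?U = (\<integral>y. indicator ?U y * ?f y \<partial>lborel)"
    using LIMSEQ_unique[OF 1[unfolded eq] 2] by simp
  then have "emeasure \<nu> ?U = ennreal (\<integral>y. indicator ?U y * ?f y \<partial>lborel)"
    by (simp add: emeasure_eq_measure)
  also have "\<dots> = (\<integral>\<^sup>+y. ennreal (indicator ?U y * ?f y) \<partial>lborel)"
    by (rule nn_integral_eq_integral[symmetric, OF I])
       (use Re_inv_fourier_char_fun_nonneg[OF \<nu> S int] in \<open>auto intro!: mult_nonneg_nonneg\<close>)
  also have "\<dots> = (\<integral>\<^sup>+y. ennreal (?f y) * indicator ?U y \<partial>lborel)"
    by (intro nn_integral_cong) (auto simp: indicator_def)
  finally show "emeasure \<nu> ?U = (\<integral>\<^sup>+y. ennreal (?f y) * indicator ?U y \<partial>lborel)" .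
qed

corollary char_fun_unique:
  fixes \<mu> \<nu> :: "'a::euclidean_space measure"
  assumes "prob_space \<mu>" "sets \<mu> = sets borel" "prob_space \<nu>" "sets \<nu> = sets borel"
    and "integrable lborel (char_fun \<nu>)" and "\<And>t. char_fun \<mu> t = char_fun \<nu> t"
  shows "\<mu> = \<nu>"
proof -
  have "char_fun \<mu> = char_fun \<nu>" using assms(6) by auto
  then show ?thesis
    using density_inv_fourier_char_fun[of \<mu>] density_inv_fourier_char_fun[of \<nu>] assms(1-5) by metis
qed

section \<open>Smoothness and decay of inverse Fourier transforms\<close>

text \<open>A class of symbols that is closed under multiplication by coordinates, hence the inverse Fourier
  transforms are closed under differentiation.\<close>

definition rapidly_decaying :: "('a::euclidean_space \<Rightarrow> complex) \<Rightarrow> bool" where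
  "rapidly_decaying h \<longleftrightarrow>
     h \<in> borel_measurable borel \<and> (\<forall>k. integrable lborel (\<lambda>w. norm w ^ k * cmod (h w)))"

lemma rapidly_decaying_measurable: "rapidly_decaying h \<Longrightarrow> h \<in> borel_measurable borel"
  by (simp add: rapidly_decaying_def)

lemma rapidly_decaying_integrable_norm:
  "rapidly_decaying h \<Longrightarrow> integrable lborel (\<lambda>w. norm w ^ k * cmod (h w))"
  by (simp add: rapidly_decaying_def)

lemma rapidly_decaying_integrable: "rapidly_decaying h \<Longrightarrow> integrable lborel h"
  using rapidly_decaying_integrable_norm[of h 0]
  by (auto simp: rapidly_decaying_measurable integrable_norm_iff)

lemma rapidly_decaying_derivative_symbol:
  assumes "rapidly_decaying h"
  shows "rapidly_decaying (\<lambda>w. - \<i> * of_real (w \<bullet> d) * h w)"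
  unfolding rapidly_decaying_def
proof (intro conjI allI)
  have [measurable]: "h \<in> borel_measurable borel"
    using assms by (rule rapidly_decaying_measurable)
  show "(\<lambda>w. - \<i> * of_real (w \<bullet> d) * h w) \<in> borel_measurable borel"
    by measurable
  fix k
  have "norm w ^ k * cmod (- \<i> * of_real (w \<bullet> d) * h w) \<le> norm d * (norm w ^ Suc k * cmod (h w))" for w
  proof -
    have "\<bar>w \<bullet> d\<bar> * (norm w ^ k * cmod (h w)) \<le> (norm w * norm d) * (norm w ^ k * cmod (h w))"
      by (intro mult_right_mono Cauchy_Schwarz_ineq2) auto
    then show ?thesis by (simp add: norm_mult mult_ac)
  qed
  then show "integrable lborel (\<lambda>w. norm w ^ k * cmod (- \<i> * of_real (w \<bullet> d) * h w))"
    by (intro Bochner_Integration.integrable_bound[OF integrable_mult_right[OF rapidly_decaying_integrable_norm[OF assms, of "Suc k"], of "norm d"]])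
       (auto intro: order.trans[OF _ abs_ge_self])
qed

lemma cmod_divide_two_pi_power_le: "cmod (z / of_real ((2 * pi) ^ n)) \<le> cmod z"
proof -
  have "1 \<le> (2 * pi) ^ n" by (rule one_le_power) (use pi_gt3 in simp)
  then have "cmod z / (2 * pi) ^ n \<le> cmod z / 1"
    by (intro divide_left_mono) auto
  moreover have "cmod (of_real ((2 * pi) ^ n)) = (2 * pi) ^ n" by (subst norm_of_real) simp
  ultimately show ?thesis unfolding norm_divide by simp
qed

text \<open>Integrated form of \<open>\<bar>exp (\<i> x) - 1 - \<i> x\<bar> \<le> x\<^sup>2/2\<close>. The explicit remainder serves twice: it
  gives differentiability, and it is uniform in \<open>x\<close>, which the decay of the derivatives requires.\<close>

lemma inv_fourier_taylor:
  fixes h :: "'a::euclidean_space \<Rightarrow> complex"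
  assumes h: "rapidly_decaying h"
  shows "cmod (inv_fourier h (x + d) - inv_fourier h x - inv_fourier (\<lambda>w. - \<i> * of_real (w \<bullet> d) * h w) x)
           \<le> (norm d)\<^sup>2 * (\<integral>w. (norm w)\<^sup>2 * cmod (h w) \<partial>lborel)"
proof -
  note hi = rapidly_decaying_integrable[OF h]
  have [measurable]: "h \<in> borel_measurable borel"
    using h by (rule rapidly_decaying_measurable)
  let ?c = "(2 * pi) ^ DIM('a)"
  let ?E = "\<lambda>w. iexp (- (w \<bullet> (x + d))) * h w - iexp (- (w \<bullet> x)) * h w
                 - iexp (- (w \<bullet> x)) * (- \<i> * of_real (w \<bullet> d) * h w)"
  have E_int: "integrable lborel ?E"
    by (intro Bochner_Integration.integrable_diff integrable_iexp_mult hi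
        rapidly_decaying_integrable rapidly_decaying_derivative_symbol h)
  have E_le: "cmod (?E w) \<le> (norm d)\<^sup>2 * ((norm w)\<^sup>2 * cmod (h w))" for w
  proof -
    have split: "iexp (- (w \<bullet> (x + d))) = iexp (- (w \<bullet> x)) * iexp (- (w \<bullet> d))"
      by (simp add: inner_add_right exp_add[symmetric] algebra_simps)
    have "?E w = iexp (- (w \<bullet> x)) * (iexp (- (w \<bullet> d)) - (\<Sum>k\<le>1. (\<i> * of_real (- (w \<bullet> d)))^k / fact k)) * h w"
      unfolding split by (simp add: algebra_simps)
    then have "cmod (?E w) = cmod (iexp (- (w \<bullet> d)) - (\<Sum>k\<le>1. (\<i> * of_real (- (w \<bullet> d)))^k / fact k)) * cmod (h w)"
      by (simp add: norm_mult)
    also have "\<dots> \<le> (\<bar>- (w \<bullet> d)\<bar> ^ Suc 1 / fact (Suc 1)) * cmod (h w)"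
      by (intro mult_right_mono iexp_approx1) auto
    also have "\<dots> \<le> (norm w * norm d)\<^sup>2 * cmod (h w)"
    proof (intro mult_right_mono)
      have "\<bar>w \<bullet> d\<bar>\<^sup>2 \<le> (norm w * norm d)\<^sup>2"
        by (intro power_mono Cauchy_Schwarz_ineq2) auto
      moreover have "0 \<le> (norm w * norm d)\<^sup>2" by simp
      moreover have "\<bar>- (w \<bullet> d)\<bar> ^ Suc 1 / fact (Suc 1) = \<bar>w \<bullet> d\<bar>\<^sup>2 / 2"
        by (simp add: power2_eq_square)
      ultimately show "\<bar>- (w \<bullet> d)\<bar> ^ Suc 1 / fact (Suc 1) \<le> (norm w * norm d)\<^sup>2"
        by linarith
    qed simp
    finally show ?thesis by (simp add: power_mult_distrib mult_ac)
  qed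
  have eq: "inv_fourier h (x + d) - inv_fourier h x - inv_fourier (\<lambda>w. - \<i> * of_real (w \<bullet> d) * h w) x
      = (CLINT w|lborel. ?E w) / of_real ?c"
    unfolding inv_fourier_def
    by (subst Bochner_Integration.integral_diff Bochner_Integration.integral_diff[OF integrable_iexp_mult integrable_iexp_mult]; (intro Bochner_Integration.integrable_diff integrable_iexp_mult hi
        rapidly_decaying_integrable rapidly_decaying_derivative_symbol h)?)+
       (simp add: diff_divide_distrib add_divide_distrib)
  have "cmod ((CLINT w|lborel. ?E w) / of_real ?c) \<le> cmod (CLINT w|lborel. ?E w)"
    by (rule cmod_divide_two_pi_power_le)
  also have "\<dots> \<le> (\<integral>w. (norm d)\<^sup>2 * ((norm w)\<^sup>2 * cmod (h w)) \<partial>lborel)"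
    by (intro Bochner_Integration.integral_norm_bound_integral[OF E_int] integrable_mult_right
        rapidly_decaying_integrable_norm h E_le)
  finally show ?thesis unfolding eq by simp
qed

lemma inv_fourier_lipschitz:
  fixes h :: "'a::euclidean_space \<Rightarrow> complex"
  assumes h: "rapidly_decaying h"
  shows "cmod (inv_fourier h x - inv_fourier h y) \<le> (\<integral>w. norm w * cmod (h w) \<partial>lborel) * norm (x - y)"
proof -
  note hi = rapidly_decaying_integrable[OF h]
  let ?c = "(2 * pi) ^ DIM('a)"
  let ?E = "\<lambda>w. iexp (- (w \<bullet> x)) * h w - iexp (- (w \<bullet> y)) * h w"
  have E_le: "cmod (?E w) \<le> norm (x - y) * (norm w ^ 1 * cmod (h w))" for w
  proof -
    have "?E w = iexp (- (w \<bullet> y)) * (iexp (- (w \<bullet> (x - y))) - (\<Sum>k\<le>0. (\<i> * of_real (- (w \<bullet> (x - y))))^k / fact k)) * h w"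
      by (simp add: inner_diff_right exp_diff exp_minus field_simps)
    then have "cmod (?E w) = cmod (iexp (- (w \<bullet> (x - y))) - (\<Sum>k\<le>0. (\<i> * of_real (- (w \<bullet> (x - y))))^k / fact k)) * cmod (h w)"
      by (simp add: norm_mult)
    also have "\<dots> \<le> (\<bar>- (w \<bullet> (x - y))\<bar> ^ Suc 0 / fact (Suc 0)) * cmod (h w)"
      by (intro mult_right_mono iexp_approx1) auto
    also have "\<dots> \<le> (norm w * norm (x - y)) * cmod (h w)"
      using Cauchy_Schwarz_ineq2[of w "x - y"] by (intro mult_right_mono) auto
    finally show ?thesis by (simp add: mult_ac)
  qed
  have eq: "inv_fourier h x - inv_fourier h y = (CLINT w|lborel. ?E w) / of_real ?c"
    unfolding inv_fourier_def
    by (subst Bochner_Integration.integral_diff[OF integrable_iexp_mult[OF hi] integrable_iexp_mult[OF hi]])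
       (simp add: diff_divide_distrib)
  have "cmod ((CLINT w|lborel. ?E w) / of_real ?c) \<le> cmod (CLINT w|lborel. ?E w)"
    by (rule cmod_divide_two_pi_power_le)
  also have "\<dots> \<le> (\<integral>w. norm (x - y) * (norm w ^ 1 * cmod (h w)) \<partial>lborel)"
    by (intro Bochner_Integration.integral_norm_bound_integral integrable_mult_right E_le
        Bochner_Integration.integrable_diff integrable_iexp_mult hi rapidly_decaying_integrable_norm[OF h])
  finally show ?thesis unfolding eq integral_mult_right_zero by (simp add: mult.commute)
qed

lemma has_derivative_Re_inv_fourier:
  fixes h :: "'a::euclidean_space \<Rightarrow> complex"
  assumes h: "rapidly_decaying h"
  shows "((\<lambda>x. Re (inv_fourier h x)) has_derivative
           (\<lambda>d. Re (inv_fourier (\<lambda>w. - \<i> * of_real (w \<bullet> d) * h w) x))) (at x)"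
  unfolding has_derivative_at
proof
  let ?D = "\<lambda>d. Re (inv_fourier (\<lambda>w. - \<i> * of_real (w \<bullet> d) * h w) x)"
  let ?C = "\<integral>w. (norm w)\<^sup>2 * cmod (h w) \<partial>lborel"
  have int: "integrable lborel (\<lambda>w. iexp (- (w \<bullet> x)) * (- \<i> * of_real (w \<bullet> d) * h w))" for d
    by (intro integrable_iexp_mult rapidly_decaying_integrable rapidly_decaying_derivative_symbol h)
  have "linear ?D"
  proof
    fix d e :: 'a and r :: real
    have "iexp (- (w \<bullet> x)) * (- \<i> * of_real (w \<bullet> (d + e)) * h w)
        = iexp (- (w \<bullet> x)) * (- \<i> * of_real (w \<bullet> d) * h w) + iexp (- (w \<bullet> x)) * (- \<i> * of_real (w \<bullet> e) * h w)" for w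
      by (simp add: inner_add_right algebra_simps)
    then show "?D (d + e) = ?D d + ?D e"
      unfolding inv_fourier_def by (simp only: Bochner_Integration.integral_add[OF int int] add_divide_distrib) simp
    have "iexp (- (w \<bullet> x)) * (- \<i> * of_real (w \<bullet> (r *\<^sub>R d)) * h w)
        = of_real r * (iexp (- (w \<bullet> x)) * (- \<i> * of_real (w \<bullet> d) * h w))" for w
      by (simp add: algebra_simps)
    then show "?D (r *\<^sub>R d) = r *\<^sub>R ?D d"
      unfolding inv_fourier_def
      by (simp only: integral_mult_right_zero times_divide_eq_right[symmetric]) simp
  qed
  then show "bounded_linear ?D"
    by (simp add: linear_conv_bounded_linear)
  show "(\<lambda>d. norm (Re (inv_fourier h (x + d)) - Re (inv_fourier h x) - ?D d) / norm d) \<midarrow>0\<rightarrow> 0"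
  proof (rule Lim_null_comparison)
    show "\<forall>\<^sub>F d in at 0. norm (norm (Re (inv_fourier h (x + d)) - Re (inv_fourier h x) - ?D d) / norm d) \<le> norm d * ?C"
    proof (intro eventuallyI)
      fix d :: 'a
      have "norm (Re (inv_fourier h (x + d)) - Re (inv_fourier h x) - ?D d) \<le> (norm d)\<^sup>2 * ?C"
        using order.trans[OF abs_Re_le_cmod inv_fourier_taylor[OF h, of x d]] by simp
      then show "norm (norm (Re (inv_fourier h (x + d)) - Re (inv_fourier h x) - ?D d) / norm d) \<le> norm d * ?C"
        by (cases "d = 0") (auto simp: field_simps power2_eq_square)
    qed
    have "((\<lambda>d::'a. norm d * ?C) \<longlongrightarrow> norm (0::'a) * ?C) (at 0)"
      by (intro tendsto_intros)
    then show "((\<lambda>d::'a. norm d * ?C) \<longlongrightarrow> 0) (at 0)" by simp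
  qed
qed

lemma filterlim_add_const_at_infinity:
  fixes c :: "'a::real_normed_vector"
  shows "filterlim (\<lambda>x. x + c) at_infinity at_infinity"
  using tendsto_add_filterlim_at_infinity'[OF filterlim_ident tendsto_const] .

text \<open>Landau's argument: a directional derivative is bounded by a difference quotient with step \<open>s\<close> plus
  \<open>s\<close> times a bound for the second derivative. The second term is small for small \<open>s\<close>, and for fixed
  \<open>s\<close> the difference quotient tends to \<open>0\<close>.\<close>

lemma inv_fourier_derivative_tendsto_0:
  fixes h :: "'a::euclidean_space \<Rightarrow> complex"
  assumes h: "rapidly_decaying h" and lim: "((\<lambda>x. Re (inv_fourier h x)) \<longlongrightarrow> 0) at_infinity"
  shows "((\<lambda>x. Re (inv_fourier (\<lambda>w. - \<i> * of_real (w \<bullet> d) * h w) x)) \<longlongrightarrow> 0) at_infinity"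
proof (rule tendstoI)
  let ?G = "\<lambda>x. Re (inv_fourier h x)"
  let ?D = "\<lambda>x. Re (inv_fourier (\<lambda>w. - \<i> * of_real (w \<bullet> d) * h w) x)"
  let ?C = "(norm d)\<^sup>2 * (\<integral>w. (norm w)\<^sup>2 * cmod (h w) \<partial>lborel)"
  have C: "0 \<le> ?C" by simp
  fix e :: real assume "0 < e"
  \<comment> \<open>Small enough for the remainder \<open>s * ?C\<close> to be below \<open>e / 2\<close>.\<close>
  define s where "s = e / (2 * (?C + 1))"
  have s: "0 < s" "s * ?C < e / 2 + 0"
    using \<open>0 < e\<close> C by (auto simp: s_def field_simps add_pos_nonneg)
  have scale: "inv_fourier (\<lambda>w. - \<i> * of_real (w \<bullet> (s *\<^sub>R d)) * h w) x
               = of_real s * inv_fourier (\<lambda>w. - \<i> * of_real (w \<bullet> d) * h w) x" for x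
  proof -
    have "iexp (- (w \<bullet> x)) * (- \<i> * of_real (w \<bullet> (s *\<^sub>R d)) * h w)
        = of_real s * (iexp (- (w \<bullet> x)) * (- \<i> * of_real (w \<bullet> d) * h w))" for w
      by (simp add: algebra_simps)
    then show ?thesis
      unfolding inv_fourier_def
      by (simp only: integral_mult_right_zero times_divide_eq_right[symmetric])
  qed
  have bound: "\<bar>?D x\<bar> \<le> (\<bar>?G (x + s *\<^sub>R d)\<bar> + \<bar>?G x\<bar>) / s + s * ?C" for x
  proof -
    have "\<bar>?G (x + s *\<^sub>R d) - ?G x - s * ?D x\<bar> \<le> s * (s * ?C)"
      using order.trans[OF abs_Re_le_cmod inv_fourier_taylor[OF h, of x "s *\<^sub>R d"]]
      unfolding scale by (simp add: power_mult_distrib power2_eq_square mult_ac)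
    then have "\<bar>s * ?D x\<bar> \<le> \<bar>?G (x + s *\<^sub>R d)\<bar> + \<bar>?G x\<bar> + s * (s * ?C)" by linarith
    then have "s * \<bar>?D x\<bar> \<le> \<bar>?G (x + s *\<^sub>R d)\<bar> + \<bar>?G x\<bar> + s * (s * ?C)"
      using s by (simp add: abs_mult)
    then show ?thesis using s by (simp add: field_simps)
  qed
  have "((\<lambda>x. (\<bar>?G (x + s *\<^sub>R d)\<bar> + \<bar>?G x\<bar>) / s) \<longlongrightarrow> (\<bar>0\<bar> + \<bar>0\<bar>) / s) at_infinity"
    using s by (intro tendsto_intros lim filterlim_compose[OF lim filterlim_add_const_at_infinity]) auto
  then have "\<forall>\<^sub>F x in at_infinity. (\<bar>?G (x + s *\<^sub>R d)\<bar> + \<bar>?G x\<bar>) / s < e / 2"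
    using \<open>0 < e\<close> by (intro order_tendstoD(2)) auto
  then show "\<forall>\<^sub>F x in at_infinity. dist (?D x) 0 < e"
  proof eventually_elim
    case (elim x)
    have "\<bar>?D x\<bar> < e" using bound[of x] elim s by linarith
    then show ?case by simp
  qed
qed

text \<open>A value \<open>e\<close> of a Lipschitz function at \<open>x\<close> forces values of at least \<open>e/2\<close> on a ball around \<open>x\<close> whose
  radius depends only on \<open>e\<close> and \<open>L\<close>. Far out this would contradict the smallness of the tail integral.\<close>

lemma integrable_lipschitz_tendsto_0:
  fixes f :: "'a::euclidean_space \<Rightarrow> real"
  assumes f: "integrable lborel f" and nonneg: "\<And>x. 0 \<le> f x"
    and lip: "\<And>x y. \<bar>f x - f y\<bar> \<le> L * norm (x - y)"
  shows "(f \<longlongrightarrow> 0) at_infinity"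
proof (rule tendstoI)
  have [measurable]: "f \<in> borel_measurable borel"
    using f by (auto dest: borel_measurable_integrable)
  fix e :: real assume "0 < e"
  \<comment> \<open>On a ball of this radius the function varies by at most \<open>e / 2\<close>.\<close>
  define r where "r = e / (2 * (\<bar>L\<bar> + 1))"
  have r: "0 < r" "\<bar>L\<bar> * r \<le> e / 2"
    using \<open>0 < e\<close> by (auto simp: r_def field_simps add_pos_nonneg)
  let ?v = "e / 2 * measure lborel (ball (0::'a) r)"
  let ?I = "\<lambda>n. \<integral>x. indicator {x. real n \<le> norm x} x * f x \<partial>lborel"
  have "?I \<longlonglongrightarrow> (\<integral>x. 0 \<partial>(lborel :: 'a measure))"
  proof (rule integral_dominated_convergence[where w=f])
    show "AE x in lborel. (\<lambda>n. indicator {x. real n \<le> norm x} x * f x) \<longlonglongrightarrow> 0"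
    proof (intro AE_I2 tendsto_eventually)
      fix x :: 'a
      obtain N :: nat where "norm x < real N" using reals_Archimedean2 by blast
      then show "\<forall>\<^sub>F n in sequentially. indicator {x. real n \<le> norm x} x * f x = 0"
        by (intro eventually_mono[OF eventually_ge_at_top[of N]]) (auto simp: indicator_def)
    qed
    show "AE x in lborel. norm (indicator {x. real n \<le> norm x} x * f x) \<le> f x" for n
      by (auto simp: indicator_def nonneg)
  qed (use f in auto)
  moreover have v: "0 < ?v"
    using \<open>0 < e\<close> r content_ball_pos[of r "0::'a"] by simp
  ultimately have "\<forall>\<^sub>F n in sequentially. ?I n < ?v"
    by (intro order_tendstoD(2)) auto
  then obtain N where N: "?I N < ?v"
    by (auto simp: eventually_sequentially)
  have "f x < e" if x: "real N + r \<le> norm x" for x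
  proof (rule ccontr)
    assume "\<not> f x < e"
    then have fx: "e \<le> f x" by simp
    have ge: "e / 2 * indicator (ball x r) y \<le> indicator {x. real N \<le> norm x} y * f y" for y
    proof (cases "y \<in> ball x r")
      case True
      then have d: "norm (x - y) < r" by (simp add: dist_norm)
      have "\<bar>f x - f y\<bar> \<le> \<bar>L\<bar> * r"
        using lip[of x y] d by (smt (verit) mult_mono norm_ge_zero)
      then have "e / 2 \<le> f y" using fx r by linarith
      moreover have "real N \<le> norm y"
        using x d norm_triangle_ineq2[of x y] by linarith
      ultimately show ?thesis using True by simp
    next
      case False
      then show ?thesis by (simp add: nonneg)
    qed
    have "(\<integral>y. e / 2 * indicator (ball x r) y \<partial>lborel) \<le> ?I N"
    proof (rule integral_mono)
      show "integrable lborel (\<lambda>y. e / 2 * indicator (ball x r) y)"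
        by (intro integrable_mult_right integrable_real_indicator[OF _ emeasure_lborel_ball_finite]) simp
      show "integrable lborel (\<lambda>y. indicator {x. real N \<le> norm x} y * f y)"
        by (rule Bochner_Integration.integrable_bound[OF f]) (auto simp: indicator_def)
    qed (rule ge)
    moreover have "(\<integral>y. e / 2 * indicator (ball x r) y \<partial>lborel) = ?v"
      using r by (simp add: content_ball)
    ultimately show False using N by linarith
  qed
  then show "\<forall>\<^sub>F x in at_infinity. dist (f x) 0 < e"
    using nonneg by (auto simp: eventually_at_infinity)
qed

lemma partial_deriv_Re_inv_fourier:
  fixes h :: "real^'n \<Rightarrow> complex"
  assumes "rapidly_decaying h"
  shows "partial_deriv i (\<lambda>x. Re (inv_fourier h x))
           = (\<lambda>x. Re (inv_fourier (\<lambda>w. - \<i> * of_real (w \<bullet> axis i 1) * h w) x))"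
proof
  fix x
  let ?D = "\<lambda>d. Re (inv_fourier (\<lambda>w. - \<i> * of_real (w \<bullet> d) * h w) x)"
  have D: "((\<lambda>x. Re (inv_fourier h x)) has_derivative ?D) (at (x + 0 *\<^sub>R axis i 1))"
    using has_derivative_Re_inv_fourier[OF assms] by simp
  have "((\<lambda>t. Re (inv_fourier h (x + t *\<^sub>R axis i 1))) has_derivative (\<lambda>t. ?D (t *\<^sub>R axis i 1))) (at 0)"
    by (rule has_derivative_compose[where f="\<lambda>t. x + t *\<^sub>R axis i 1"
          and g="\<lambda>x. Re (inv_fourier h x)" and g'="?D", OF _ D]) (auto intro!: derivative_eq_intros)
  moreover have "?D (t *\<^sub>R axis i 1) = ?D (axis i 1) * t" for t
    using linear_cmul[OF has_derivative_linear[OF D], of t "axis i 1"] by (simp add: mult.commute)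
  ultimately have "((\<lambda>t. Re (inv_fourier h (x + t *\<^sub>R axis i 1))) has_field_derivative ?D (axis i 1)) (at 0)"
    by (simp add: has_field_derivative_def)
  then show "partial_deriv i (\<lambda>x. Re (inv_fourier h x)) x = ?D (axis i 1)"
    unfolding partial_deriv_def by (rule DERIV_imp_deriv)
qed

text \<open>The induction carries the decay at infinity along with the representation, since each derivative
  inherits it from the previous one.\<close>

lemma iterated_partial_deriv_inv_fourier:
  fixes h :: "real^'n \<Rightarrow> complex"
  assumes "rapidly_decaying h"
  shows "\<exists>k. rapidly_decaying k \<and> iterated_partial_deriv is (\<lambda>x. Re (inv_fourier h x)) = (\<lambda>x. Re (inv_fourier k x))
           \<and> (((\<lambda>x. Re (inv_fourier h x)) \<longlongrightarrow> 0) at_infinity \<longrightarrow> ((\<lambda>x. Re (inv_fourier k x)) \<longlongrightarrow> 0) at_infinity)"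
proof (induction "is")
  case Nil
  show ?case using assms by (auto simp: iterated_partial_deriv_def)
next
  case (Cons i "is")
  then obtain k where k: "rapidly_decaying k" "iterated_partial_deriv is (\<lambda>x. Re (inv_fourier h x)) = (\<lambda>x. Re (inv_fourier k x))"
      "((\<lambda>x. Re (inv_fourier h x)) \<longlongrightarrow> 0) at_infinity \<longrightarrow> ((\<lambda>x. Re (inv_fourier k x)) \<longlongrightarrow> 0) at_infinity"
    by blast
  have "iterated_partial_deriv (i # is) (\<lambda>x. Re (inv_fourier h x)) = partial_deriv i (\<lambda>x. Re (inv_fourier k x))"
    using k(2) by (simp add: iterated_partial_deriv_def)
  also have "\<dots> = (\<lambda>x. Re (inv_fourier (\<lambda>w. - \<i> * of_real (w \<bullet> axis i 1) * k w) x))"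
    by (rule partial_deriv_Re_inv_fourier[OF k(1)])
  finally show ?case
    using k(3) inv_fourier_derivative_tendsto_0[OF k(1), of "axis i 1"]
    by (intro exI[of _ "\<lambda>w. - \<i> * of_real (w \<bullet> axis i 1) * k w"] conjI impI
        rapidly_decaying_derivative_symbol[OF k(1)]) auto
qed

text \<open>Decay of the density itself comes from its being integrable and Lipschitz continuous; from there it is
  passed on to one derivative after the other.\<close>

theorem smooth_density_of_rapidly_decaying_char_fun:
  fixes \<nu> :: "(real^'n) measure"
  assumes \<nu>: "prob_space \<nu>" and S: "sets \<nu> = sets borel" and decay: "rapidly_decaying (char_fun \<nu>)"
  shows "\<exists>f. (\<forall>x. 0 \<le> f x) \<and> \<nu> = density lborel (\<lambda>x. ennreal (f x)) \<and> infinitely_differentiable f \<and>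
           (\<forall>is. (iterated_partial_deriv is f \<longlongrightarrow> 0) at_infinity)"
proof -
  let ?f = "\<lambda>x. Re (inv_fourier (char_fun \<nu>) x)"
  note int = rapidly_decaying_integrable[OF decay]
  have [measurable]: "char_fun \<nu> \<in> borel_measurable borel"
    using decay by (rule rapidly_decaying_measurable)
  have nonneg: "0 \<le> ?f x" for x
    by (rule Re_inv_fourier_char_fun_nonneg[OF \<nu> S int])
  have dens: "\<nu> = density lborel (\<lambda>x. ennreal (?f x))"
    by (rule density_inv_fourier_char_fun[OF \<nu> S int])
  have "(\<integral>\<^sup>+x. ennreal (?f x) \<partial>lborel) = emeasure \<nu> UNIV"
    by (subst dens) (simp add: emeasure_density)
  also have "\<dots> = 1"
    using prob_space.emeasure_space_1[OF \<nu>] sets_eq_imp_space_eq[OF S] by simp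
  finally have "integrable lborel ?f"
    using nonneg by (intro integrableI_nonneg) auto
  then have lim: "(?f \<longlongrightarrow> 0) at_infinity"
  proof (rule integrable_lipschitz_tendsto_0[OF _ nonneg])
    show "\<bar>?f x - ?f y\<bar> \<le> (\<integral>w. norm w * cmod (char_fun \<nu> w) \<partial>lborel) * norm (x - y)" for x y
      using order.trans[OF abs_Re_le_cmod inv_fourier_lipschitz[OF decay, of x y]] by simp
  qed
  have smooth: "infinitely_differentiable ?f"
    unfolding infinitely_differentiable_def
  proof (intro allI)
    fix "is" :: "'n list" and x
    obtain k where "rapidly_decaying k" "iterated_partial_deriv is ?f = (\<lambda>x. Re (inv_fourier k x))"
      using iterated_partial_deriv_inv_fourier[OF decay] by blast
    then show "iterated_partial_deriv is ?f differentiable (at x)"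
      using has_derivative_Re_inv_fourier by (auto simp: differentiable_def)
  qed
  have deriv_lim: "(iterated_partial_deriv is ?f \<longlongrightarrow> 0) at_infinity" for "is"
  proof -
    obtain k where "iterated_partial_deriv is ?f = (\<lambda>x. Re (inv_fourier k x))"
        "(?f \<longlongrightarrow> 0) at_infinity \<longrightarrow> ((\<lambda>x. Re (inv_fourier k x)) \<longlongrightarrow> 0) at_infinity"
      using iterated_partial_deriv_inv_fourier[OF decay, of "is"] by blast
    then show ?thesis using lim by simp
  qed
  show ?thesis
    by (intro exI[of _ ?f] conjI allI) (rule nonneg dens smooth deriv_lim)+
qed

section \<open>The exponential formula for Poisson point processes\<close>

lemma cmod_exp_minus_1_le:
  assumes "Re z \<le> 0"
  shows "cmod (exp z - 1) \<le> 2 * min 1 (cmod z)"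
proof -
  have "cmod (exp z) \<le> 1" using assms by simp
  then have 1: "cmod (exp z - 1) \<le> 2"
    using norm_triangle_ineq4[of "exp z" 1] unfolding norm_one by linarith
  have "cmod (exp z - exp 0) \<le> 1 * cmod (z - 0)"
  proof (rule field_differentiable_bound)
    show "convex {z. Re z \<le> 0}" by (rule convex_halfspace_Re_le)
    show "(exp has_field_derivative exp z) (at z within {z. Re z \<le> 0})" for z :: complex
      by (rule has_field_derivative_at_within[OF DERIV_exp])
  qed (use assms in auto)
  then have "cmod (exp z - 1) \<le> cmod z" by simp
  moreover have "cmod z \<le> 2 * cmod z" by simp
  ultimately show ?thesis using 1 by linarith
qed

text \<open>The point probabilities already sum to \<open>1\<close>, so that the count is almost surely one of the natural
  numbers, and the exponential moment is a sum over its values.\<close>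

lemma
  assumes "prob_space M" and X: "poisson_distributed M \<Lambda> X" and fin: "\<Lambda> \<noteq> \<infinity>"
  shows poisson_distributed_finite: "AE \<omega> in M. X \<omega> \<noteq> \<infinity>"
    and poisson_distributed_exp: "Re r \<le> 0 \<Longrightarrow>
      (CLINT \<omega>|M. exp (r * of_real (enn2real (X \<omega>)))) = exp (of_real (enn2real \<Lambda>) * (exp r - 1))"
proof -
  interpret prob_space M by fact
  let ?l = "enn2real \<Lambda>"
  have [measurable]: "X \<in> borel_measurable M"
    and pX: "\<And>k. prob {\<omega> \<in> space M. X \<omega> = of_nat k} = ?l ^ k / fact k * exp (- ?l)"
    using X fin by (auto simp: poisson_distributed_def)
  define A where "A k = {\<omega> \<in> space M. X \<omega> = of_nat k}" for k :: nat
  have A[measurable]: "A k \<in> events" for k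
    unfolding A_def by measurable
  have pA: "prob (A k) = ?l ^ k / fact k * exp (- ?l)" for k
    unfolding A_def by (rule pX)
  have exp_real: "(\<lambda>k. ?l ^ k / fact k * exp (- ?l)) sums (exp ?l * exp (- ?l))"
    using exp_converges[of ?l] by (intro sums_mult2) (simp add: field_simps)
  have "(\<lambda>k. prob (A k)) sums prob (\<Union>k. A k)"
    by (intro finite_measure_UNION) (auto simp: disjoint_family_on_def A_def)
  moreover have "(\<lambda>k. prob (A k)) sums 1"
    using exp_real by (simp add: pA exp_minus_inverse)
  ultimately have "prob (\<Union>k. A k) = 1"
    by (rule sums_unique2)
  then have ae: "AE \<omega> in M. \<omega> \<in> (\<Union>k. A k)"
    by (rule AE_prob_1)
  then show "AE \<omega> in M. X \<omega> \<noteq> \<infinity>"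
    by eventually_elim (auto simp: A_def)
  assume r: "Re r \<le> 0"
  let ?F = "\<lambda>k \<omega>. indicator (A k) \<omega> *\<^sub>R exp (r * of_nat k)"
  have unique: "(\<lambda>k. ?F k \<omega>) = (\<lambda>k. if k = j then exp (r * of_nat k) else 0)" if "\<omega> \<in> A j" for j \<omega>
    using that by (auto simp: A_def indicator_def fun_eq_iff)
  have le1: "cmod (exp (r * of_nat k)) \<le> 1" for k
    using r by (simp add: mult_nonpos_nonneg)
  have "(\<lambda>k. integral\<^sup>L M (?F k)) sums (CLINT \<omega>|M. \<Sum>k. ?F k \<omega>)"
  proof (rule sums_integral)
    show "AE \<omega> in M. summable (\<lambda>k. norm (?F k \<omega>))"
      using ae
    proof eventually_elim
      case (elim \<omega>)
      then obtain j where "\<omega> \<in> A j" by auto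
      show ?case
        by (rule summable_finite[of "{j}"]) (use \<open>\<omega> \<in> A j\<close> in \<open>auto simp: A_def indicator_def\<close>)
    qed
    show "summable (\<lambda>k. \<integral>\<omega>. norm (?F k \<omega>) \<partial>M)"
    proof (rule summable_comparison_test')
      show "summable (\<lambda>k. prob (A k))"
        using exp_real by (simp add: pA sums_iff)
      show "norm (\<integral>\<omega>. norm (?F k \<omega>) \<partial>M) \<le> prob (A k)" if "k \<ge> 0" for k
        using le1[of k] by (simp add: mult_left_le)
    qed
    show "integrable M (?F k)" for k
      by (intro integrable_scaleR_left integrable_real_indicator A) (simp add: emeasure_eq_measure)
  qed
  moreover have "(\<lambda>k. integral\<^sup>L M (?F k)) sums exp (of_real ?l * (exp r - 1))"
  proof -
    have "(\<lambda>k. of_real (exp (- ?l)) * ((of_real ?l * exp r) ^ k /\<^sub>R fact k)) sums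
            (of_real (exp (- ?l)) * exp (of_real ?l * exp r))"
      by (intro sums_mult exp_converges)
    also have "(\<lambda>k. of_real (exp (- ?l)) * ((of_real ?l * exp r) ^ k /\<^sub>R fact k)) = (\<lambda>k. integral\<^sup>L M (?F k))"
      by (auto simp: fun_eq_iff pA scaleR_conv_of_real power_mult_distrib exp_of_nat2_mult field_simps)
    also have "of_real (exp (- ?l)) * exp (of_real ?l * exp r) = exp (of_real ?l * (exp r - 1))"
      by (simp add: exp_of_real[symmetric] exp_add[symmetric] algebra_simps)
    finally show ?thesis .
  qed
  ultimately have "(CLINT \<omega>|M. \<Sum>k. ?F k \<omega>) = exp (of_real ?l * (exp r - 1))"
    by (rule sums_unique2)
  moreover have "(CLINT \<omega>|M. exp (r * of_real (enn2real (X \<omega>)))) = (CLINT \<omega>|M. \<Sum>k. ?F k \<omega>)"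
  proof (rule integral_cong_AE)
    show "AE \<omega> in M. exp (r * of_real (enn2real (X \<omega>))) = (\<Sum>k. ?F k \<omega>)"
      using ae
    proof eventually_elim
      case (elim \<omega>)
      then obtain j where j: "\<omega> \<in> A j" by auto
      have "(\<Sum>k. ?F k \<omega>) = exp (r * of_nat j)"
        unfolding unique[OF j] by (rule sums_unique[OF sums_single, symmetric])
      then show ?case using j by (simp add: A_def)
    qed
  qed measurable
  ultimately show "(CLINT \<omega>|M. exp (r * of_real (enn2real (X \<omega>)))) = exp (of_real ?l * (exp r - 1))"
    by simp
qed

lemma emeasure_sum_of_diracs:
  "B \<in> sets borel \<Longrightarrow> emeasure (sum_of_diracs p) B = emeasure (count_space UNIV) {i. p i \<in> B}"
  unfolding sum_of_diracs_def by (subst emeasure_distr) (auto simp: vimage_def)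

lemma suminf_eq_sum_over_values:
  fixes g :: "real \<Rightarrow> complex"
  assumes fin: "finite (range g)" and g[measurable]: "g \<in> borel_measurable borel"
    and count: "\<And>r. r \<in> range g - {0} \<Longrightarrow> emeasure (sum_of_diracs p) (g -` {r}) \<noteq> \<infinity>"
  shows "(\<Sum>i. g (p i)) = (\<Sum>r\<in>range g - {0}. r * of_real (enn2real (emeasure (sum_of_diracs p) (g -` {r}))))"
proof -
  let ?R = "range g - {0}"
  let ?I = "\<lambda>r. {i. g (p i) = r}"
  have em: "emeasure (sum_of_diracs p) (g -` {r}) = emeasure (count_space UNIV) (?I r)" for r
    using measurable_sets[OF g, of "{r}"] by (subst emeasure_sum_of_diracs) (auto simp: vimage_def)
  have finI: "finite (?I r)" if "r \<in> ?R" for r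
    using count[OF that] unfolding em by (auto simp: emeasure_count_space split: if_splits)
  have U: "{i. g (p i) \<noteq> 0} = (\<Union>r\<in>?R. ?I r)" by auto
  then have "(\<Sum>i. g (p i)) = (\<Sum>i\<in>(\<Union>r\<in>?R. ?I r). g (p i))"
    by (intro suminf_finite) (use fin finI in auto)
  also have "\<dots> = (\<Sum>r\<in>?R. \<Sum>i\<in>?I r. g (p i))"
    by (rule sum.UNION_disjoint) (use fin finI in auto)
  also have "\<dots> = (\<Sum>r\<in>?R. r * of_real (enn2real (emeasure (sum_of_diracs p) (g -` {r}))))"
    using finI by (intro sum.cong refl) (auto simp: em emeasure_count_space mult.commute)
  finally show ?thesis .
qed

lemma integral_exp_minus_1_of_finite_range:
  fixes g :: "real \<Rightarrow> complex"
  assumes S[measurable_cong]: "sets \<Lambda> = sets borel" and fin: "finite (range g)"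
    and g[measurable]: "g \<in> borel_measurable borel"
    and \<Lambda>: "\<And>r. r \<noteq> 0 \<Longrightarrow> emeasure \<Lambda> (g -` {r}) \<noteq> \<infinity>"
  shows "(CLINT y|\<Lambda>. exp (g y) - 1) = (\<Sum>r\<in>range g - {0}. of_real (enn2real (emeasure \<Lambda> (g -` {r}))) * (exp r - 1))"
proof -
  let ?R = "range g - {0}"
  have [measurable]: "g -` {r} \<in> sets \<Lambda>" for r
    using measurable_sets[OF g, of "{r}"] S by simp
  have "exp (g y) - 1 = (\<Sum>r\<in>?R. indicator (g -` {r}) y *\<^sub>R (exp r - 1))" for y
  proof (cases "g y = 0")
    case True
    then show ?thesis by (subst sum.neutral) (auto simp: indicator_def)
  next
    case False
    then have "(\<Sum>r\<in>?R. indicator (g -` {r}) y *\<^sub>R (exp r - 1)) = (\<Sum>r\<in>{g y}. indicator (g -` {r}) y *\<^sub>R (exp r - 1))"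
      using fin by (intro sum.mono_neutral_right) auto
    then show ?thesis by simp
  qed
  then have "(CLINT y|\<Lambda>. exp (g y) - 1) = (CLINT y|\<Lambda>. \<Sum>r\<in>?R. indicator (g -` {r}) y *\<^sub>R (exp r - 1))"
    by simp
  also have "\<dots> = (\<Sum>r\<in>?R. CLINT y|\<Lambda>. indicator (g -` {r}) y *\<^sub>R (exp r - 1))"
    by (rule Bochner_Integration.integral_sum)
       (use \<Lambda> in \<open>auto intro!: integrable_scaleR_left integrable_real_indicator simp: less_top\<close>)
  also have "\<dots> = (\<Sum>r\<in>?R. of_real (enn2real (emeasure \<Lambda> (g -` {r}))) * (exp r - 1))"
    by (intro sum.cong refl, subst integral_scaleR_left)
       (use \<Lambda> in \<open>auto intro!: integrable_real_indicator simp: less_top measure_def scaleR_conv_of_real\<close>)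
  finally show ?thesis .
qed

text \<open>If \<open>g\<close> takes finitely many values then the sum over the points is a linear combination of the counts
  of the disjoint level sets. These counts are independent and Poisson distributed.\<close>

lemma poisson_exponential_formula_simple:
  fixes g :: "real \<Rightarrow> complex"
  assumes "prob_space M" and P[measurable]: "\<And>i. P i \<in> borel_measurable M"
    and ppp: "poisson_point_process M \<Lambda> (\<lambda>\<omega>. sum_of_diracs (\<lambda>i. P i \<omega>))"
    and S: "sets \<Lambda> = sets borel" and fin: "finite (range g)"
    and g[measurable]: "g \<in> borel_measurable borel"
    and \<Lambda>: "\<And>r. r \<noteq> 0 \<Longrightarrow> emeasure \<Lambda> (g -` {r}) \<noteq> \<infinity>" and Re_g: "\<And>y. Re (g y) \<le> 0"
  shows "(CLINT \<omega>|M. exp (\<Sum>i. g (P i \<omega>))) = exp (CLINT y|\<Lambda>. exp (g y) - 1)"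
proof -
  interpret prob_space M by fact
  let ?R = "range g - {0}"
  let ?\<xi> = "\<lambda>\<omega>. sum_of_diracs (\<lambda>i. P i \<omega>)"
  have Bs: "g -` {r} \<in> sets \<Lambda>" for r
    using measurable_sets[OF g, of "{r}"] S by simp
  have poi: "poisson_distributed M (emeasure \<Lambda> (g -` {r})) (\<lambda>\<omega>. emeasure (?\<xi> \<omega>) (g -` {r}))" for r
    using ppp Bs by (auto simp: poisson_point_process_def)
  then have [measurable]: "(\<lambda>\<omega>. emeasure (?\<xi> \<omega>) (g -` {r})) \<in> borel_measurable M" for r
    by (auto simp: poisson_distributed_def)
  \<comment> \<open>The definition of a Poisson process indexes families of disjoint sets by natural numbers.\<close>
  obtain e where e: "bij_betw e {..<card ?R} ?R"
    using ex_bij_betw_nat_finite[of ?R] fin by (auto simp: atLeast0LessThan)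
  let ?J = "{..<card ?R}"
  have eR: "e j \<in> ?R" if "j \<in> ?J" for j
    using e that by (auto simp: bij_betw_def)
  have Re_r: "Re r \<le> 0" if "r \<in> ?R" for r
    using that Re_g by auto
  let ?X = "\<lambda>r \<omega>. exp (r * of_real (enn2real (emeasure (?\<xi> \<omega>) (g -` {r})))) :: complex"
  have disj: "disjoint_family_on (\<lambda>j. g -` {e j}) ?J"
    using e by (auto simp: disjoint_family_on_def bij_betw_def inj_on_def)
  have "indep_vars (\<lambda>_. borel) (\<lambda>j \<omega>. emeasure (?\<xi> \<omega>) (g -` {e j})) ?J"
    by (rule ppp[unfolded poisson_point_process_def, THEN conjunct2, THEN conjunct2, rule_format])
       (use disj Bs in auto)
  then have indep: "indep_vars (\<lambda>_. borel) (\<lambda>j. ?X (e j)) ?J"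
    by (rule indep_vars_compose2[where Y="\<lambda>j x. exp (e j * of_real (enn2real x))"]) measurable
  have Xint: "integrable M (?X r)" if "r \<in> ?R" for r
    using Re_r[OF that] by (intro integrable_const_bound[where B=1]) (auto intro!: AE_I2 mult_nonpos_nonneg)
  have "AE \<omega> in M. \<forall>r\<in>?R. emeasure (?\<xi> \<omega>) (g -` {r}) \<noteq> \<infinity>"
    using fin \<Lambda> poisson_distributed_finite[OF \<open>prob_space M\<close> poi]
    by (intro AE_finite_allI) auto
  then have "AE \<omega> in M. exp (\<Sum>i. g (P i \<omega>)) = (\<Prod>j\<in>?J. ?X (e j) \<omega>)"
  proof eventually_elim
    case (elim \<omega>)
    have "(\<Sum>i. g (P i \<omega>)) = (\<Sum>r\<in>?R. r * of_real (enn2real (emeasure (?\<xi> \<omega>) (g -` {r}))))"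
      using elim by (intro suminf_eq_sum_over_values[OF fin g]) auto
    then have "exp (\<Sum>i. g (P i \<omega>)) = (\<Prod>r\<in>?R. ?X r \<omega>)"
      using fin by (simp add: exp_sum)
    also have "\<dots> = (\<Prod>j\<in>?J. ?X (e j) \<omega>)"
      by (rule prod.reindex_bij_betw[OF e, symmetric])
    finally show ?case .
  qed
  then have "(CLINT \<omega>|M. exp (\<Sum>i. g (P i \<omega>))) = (CLINT \<omega>|M. \<Prod>j\<in>?J. ?X (e j) \<omega>)"
    by (intro integral_cong_AE) measurable
  also have "\<dots> = (\<Prod>j\<in>?J. CLINT \<omega>|M. ?X (e j) \<omega>)"
    by (rule indep_vars_lebesgue_integral[OF _ indep]) (use Xint eR in auto)
  also have "\<dots> = (\<Prod>r\<in>?R. CLINT \<omega>|M. ?X r \<omega>)"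
    by (rule prod.reindex_bij_betw[OF e])
  also have "\<dots> = (\<Prod>r\<in>?R. exp (of_real (enn2real (emeasure \<Lambda> (g -` {r}))) * (exp r - 1)))"
    using \<Lambda> Re_r by (intro prod.cong refl poisson_distributed_exp[OF \<open>prob_space M\<close> poi]) auto
  also have "\<dots> = exp (CLINT y|\<Lambda>. exp (g y) - 1)"
    using fin by (simp add: integral_exp_minus_1_of_finite_range[OF S fin g \<Lambda>] exp_sum)
  finally show ?thesis .
qed

lemma suminf_dominated_convergence:
  fixes f :: "nat \<Rightarrow> nat \<Rightarrow> 'a::{banach, second_countable_topology}"
  assumes "summable h" and "\<And>n i. norm (f n i) \<le> h i" and "\<And>i. (\<lambda>n. f n i) \<longlonglongrightarrow> g i"
  shows "(\<lambda>n. \<Sum>i. f n i) \<longlonglongrightarrow> (\<Sum>i. g i)"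
proof -
  have h: "norm (h i) = h i" for i
    using order.trans[OF norm_ge_zero assms(2)] by simp
  have g: "norm (g i) \<le> h i" for i
    by (rule LIMSEQ_le_const2[OF tendsto_norm[OF assms(3)]]) (use assms(2) in auto)
  have "(\<lambda>n. \<integral>i. f n i \<partial>count_space UNIV) \<longlonglongrightarrow> (\<integral>i. g i \<partial>count_space UNIV)"
    by (rule integral_dominated_convergence[where w=h])
       (use assms in \<open>auto simp: integrable_count_space_nat_iff h[simplified]\<close>)
  moreover have "(\<integral>i. f n i \<partial>count_space UNIV) = (\<Sum>i. f n i)" for n
    by (intro integral_count_space_nat)
       (auto simp: integrable_count_space_nat_iff intro!: summable_comparison_test'[OF assms(1)] assms(2))
  moreover have "(\<integral>i. g i \<partial>count_space UNIV) = (\<Sum>i. g i)"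
    by (intro integral_count_space_nat)
       (auto simp: integrable_count_space_nat_iff intro!: summable_comparison_test'[OF assms(1)] g)
  ultimately show ?thesis by simp
qed


text \<open>Campbell's formula for the exponential functional. Rounding the points down to a grid reduces it to
  finitely many values; the condition on the real part keeps all exponentials bounded by \<open>1\<close>, and \<open>h\<close>
  provides the majorants for both the sum over the points and the integral over the intensity.\<close>

lemma poisson_exponential_formula:
  fixes g :: "real \<Rightarrow> complex"
  assumes "prob_space M" and P[measurable]: "\<And>i. P i \<in> borel_measurable M"
    and ppp: "poisson_point_process M \<Lambda> (\<lambda>\<omega>. sum_of_diracs (\<lambda>i. P i \<omega>))"
    and S[measurable_cong]: "sets \<Lambda> = sets borel"
    and cont: "continuous_on UNIV g" and g0: "\<And>y. y \<le> 0 \<Longrightarrow> g y = 0" and Re_g: "\<And>y. Re (g y) \<le> 0"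
    and g_le: "\<And>y. cmod (g y) \<le> h y" and mono: "mono h"
    and summ: "AE \<omega> in M. summable (\<lambda>i. h (P i \<omega>))"
    and \<Lambda>: "\<And>\<delta>. 0 < \<delta> \<Longrightarrow> emeasure \<Lambda> {\<delta>..} \<noteq> \<infinity>"
    and int: "integrable \<Lambda> (\<lambda>y. min 1 (h y))"
  shows "(CLINT \<omega>|M. exp (\<Sum>i. g (P i \<omega>))) = exp (CLINT y|\<Lambda>. exp (g y) - 1)"
proof -
  interpret prob_space M by fact
  have [measurable]: "g \<in> borel_measurable borel"
    using cont by (rule borel_measurable_continuous_onI)
  \<comment> \<open>Rounding down to multiples of \<open>1/(n+1)\<close>; points from \<open>n\<close> on are moved to \<open>0\<close>, where \<open>g\<close> vanishes, to keep the range finite.\<close>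
  define d where "d n y = (if 0 < y \<and> y < real n then of_int \<lfloor>real (Suc n) * y\<rfloor> / real (Suc n) else 0)"
    for n :: nat and y :: real
  have [measurable]: "d n \<in> borel_measurable borel" for n
    unfolding d_def[abs_def] by measurable
  have d_le: "d n y \<le> max 0 y" for n y
  proof -
    have "of_int \<lfloor>real (Suc n) * y\<rfloor> \<le> real (Suc n) * y" by simp
    then have "of_int \<lfloor>real (Suc n) * y\<rfloor> / real (Suc n) \<le> y"
      by (simp add: divide_le_eq mult.commute)
    then show ?thesis by (simp add: d_def)
  qed
  have d_lim: "(\<lambda>n. d n y) \<longlonglongrightarrow> max 0 y" for y
  proof (cases "0 < y")
    case True
    obtain N :: nat where N: "y < real N" using reals_Archimedean2 by blast
    show ?thesis
    proof (rule tendsto_sandwich)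
      show "\<forall>\<^sub>F n in sequentially. max 0 y - 1 / real (Suc n) \<le> d n y"
        using eventually_ge_at_top[of N]
      proof eventually_elim
        case (elim n)
        have "real (Suc n) * y - 1 \<le> of_int \<lfloor>real (Suc n) * y\<rfloor>" by linarith
        then have "(real (Suc n) * y - 1) / real (Suc n) \<le> of_int \<lfloor>real (Suc n) * y\<rfloor> / real (Suc n)"
          by (intro divide_right_mono) auto
        moreover have "(real (Suc n) * y - 1) / real (Suc n) = y - 1 / real (Suc n)"
          by (simp add: diff_divide_distrib)
        ultimately show ?case using True N elim by (simp add: d_def)
      qed
      show "\<forall>\<^sub>F n in sequentially. d n y \<le> max 0 y"
        by (intro always_eventually allI d_le)
      have "(\<lambda>n. max 0 y - 1 / real (Suc n)) \<longlonglongrightarrow> max 0 y - 0"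
        by (intro tendsto_diff tendsto_const LIMSEQ_Suc[OF lim_1_over_n])
      then show "(\<lambda>n. max 0 y - 1 / real (Suc n)) \<longlonglongrightarrow> max 0 y" by simp
    qed (rule tendsto_const)
  next
    case False
    then show ?thesis by (simp add: d_def)
  qed
  have g_max: "g (max 0 y) = g y" for y
    using g0 by (auto simp: max_def)
  have gd_lim: "(\<lambda>n. g (d n y)) \<longlonglongrightarrow> g y" for y
    using isCont_tendsto_compose[OF _ d_lim, of y g] cont
    by (simp add: g_max continuous_on_eq_continuous_at)
  have gd_le: "cmod (g (d n y)) \<le> h y" for n y
  proof (cases "0 < y")
    case True
    then have "h (d n y) \<le> h y" using mono d_le[of n y] by (auto intro: monoD)
    then show ?thesis using g_le order.trans by blast
  next
    case False
    then show ?thesis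
      using g0[of 0] order.trans[OF norm_ge_zero g_le[of y]] by (simp add: d_def)
  qed
  have simple: "(CLINT \<omega>|M. exp (\<Sum>i. g (d n (P i \<omega>)))) = exp (CLINT y|\<Lambda>. exp (g (d n y)) - 1)" for n
  proof (rule poisson_exponential_formula_simple[OF \<open>prob_space M\<close> P ppp S])
    have "d n y \<in> (\<lambda>k. of_int k / real (Suc n)) ` {0..int (Suc n * n)}" for y
    proof (cases "0 < y \<and> y < real n")
      case True
      then have "real (Suc n) * y \<le> real (Suc n) * real n" by (intro mult_left_mono) auto
      then have "\<lfloor>real (Suc n) * y\<rfloor> \<le> int (Suc n * n)"
        using floor_mono[of "real (Suc n) * y" "real (Suc n * n)"] by (simp only: of_nat_mult[symmetric] floor_of_nat)
      moreover have "0 \<le> \<lfloor>real (Suc n) * y\<rfloor>" using True by simp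
      ultimately show ?thesis using True by (auto simp: d_def)
    next
      case False
      then show ?thesis by (auto simp: d_def intro!: image_eqI[of _ _ 0])
    qed
    then have "finite (range (d n))"
      by (intro finite_subset[OF _ finite_imageI[of "{0..int (Suc n * n)}" "\<lambda>k. of_int k / real (Suc n)"]]) auto
    then show "finite (range (\<lambda>y. g (d n y)))"
      using finite_imageI[of "range (d n)" g] by (simp add: image_image)
    show "emeasure \<Lambda> ((\<lambda>y. g (d n y)) -` {r}) \<noteq> \<infinity>" if "r \<noteq> 0" for r
    proof -
      have "1 / real (Suc n) \<le> y" if "g (d n y) \<noteq> 0" for y
      proof (rule ccontr)
        assume "\<not> 1 / real (Suc n) \<le> y"
        then have "y < 1 / real (Suc n)" by simp
        then have "real (Suc n) * y < 1" by (simp add: field_simps)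
        then have "0 < y \<Longrightarrow> \<lfloor>real (Suc n) * y\<rfloor> = 0" by (intro floor_unique) auto
        then have "d n y = 0" by (auto simp: d_def)
        then show False using that g0[of 0] by simp
      qed
      then have "(\<lambda>y. g (d n y)) -` {r} \<subseteq> {1 / real (Suc n)..}" using that by auto
      then have "emeasure \<Lambda> ((\<lambda>y. g (d n y)) -` {r}) \<le> emeasure \<Lambda> {1 / real (Suc n)..}"
        by (rule emeasure_mono) (simp add: S)
      then show ?thesis
        using \<Lambda>[of "1 / real (Suc n)"] by (auto simp: top_unique)
    qed
  qed (auto intro: Re_g)
  have "(\<lambda>n. CLINT \<omega>|M. exp (\<Sum>i. g (d n (P i \<omega>)))) \<longlonglongrightarrow> (CLINT \<omega>|M. exp (\<Sum>i. g (P i \<omega>)))"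
  proof (rule integral_dominated_convergence[where w="\<lambda>_. 1"])
    show "AE \<omega> in M. (\<lambda>n. exp (\<Sum>i. g (d n (P i \<omega>)))) \<longlonglongrightarrow> exp (\<Sum>i. g (P i \<omega>))"
      using summ
      by eventually_elim (intro tendsto_exp suminf_dominated_convergence, assumption, rule gd_le, rule gd_lim)
    show "AE \<omega> in M. norm (exp (\<Sum>i. g (d n (P i \<omega>)))) \<le> 1" for n
      using summ
    proof eventually_elim
      case (elim \<omega>)
      have s: "summable (\<lambda>i. g (d n (P i \<omega>)))"
        by (rule summable_comparison_test'[OF elim]) (rule gd_le)
      have "Re (\<Sum>i. g (d n (P i \<omega>))) = (\<Sum>i. Re (g (d n (P i \<omega>))))"
        by (rule bounded_linear.suminf[OF bounded_linear_Re s])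
      also have "\<dots> \<le> (\<Sum>i::nat. 0)"
        by (intro suminf_le Re_g summable_zero bounded_linear.summable[OF bounded_linear_Re s])
      finally show ?case by simp
    qed
  qed auto
  moreover have "(\<lambda>n. exp (CLINT y|\<Lambda>. exp (g (d n y)) - 1)) \<longlonglongrightarrow> exp (CLINT y|\<Lambda>. exp (g y) - 1)"
  proof (intro tendsto_exp integral_dominated_convergence[where w="\<lambda>y. 2 * min 1 (h y)"])
    show "integrable \<Lambda> (\<lambda>y. 2 * min 1 (h y))"
      using int by (rule integrable_mult_right)
    show "AE y in \<Lambda>. (\<lambda>n. exp (g (d n y)) - 1) \<longlonglongrightarrow> exp (g y) - 1"
      by (intro AE_I2 tendsto_intros gd_lim)
    show "AE y in \<Lambda>. norm (exp (g (d n y)) - 1) \<le> 2 * min 1 (h y)" for n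
    proof (intro AE_I2)
      fix y
      have "norm (exp (g (d n y)) - 1) \<le> 2 * min 1 (cmod (g (d n y)))"
        by (rule cmod_exp_minus_1_le[OF Re_g])
      also have "\<dots> \<le> 2 * min 1 (h y)"
        using gd_le[of n y] by auto
      finally show "norm (exp (g (d n y)) - 1) \<le> 2 * min 1 (h y)" .
    qed
  qed measurable
  ultimately show ?thesis
    unfolding simple by (rule LIMSEQ_unique)
qed

text \<open>A Poisson variable with mean \<open>0\<close> is almost surely \<open>0\<close>. This is used for the half-line of nonpositive
  numbers, to see that all points are positive.\<close>

lemma poisson_point_process_AE_notin:
  assumes "prob_space M" and ppp: "poisson_point_process M \<Lambda> (\<lambda>\<omega>. sum_of_diracs (\<lambda>i. P i \<omega>))"
    and B: "B \<in> sets \<Lambda>" and S: "sets \<Lambda> = sets borel" and null: "emeasure \<Lambda> B = 0"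
  shows "AE \<omega> in M. \<forall>i. P i \<omega> \<notin> B"
proof -
  interpret prob_space M by fact
  have "poisson_distributed M 0 (\<lambda>\<omega>. emeasure (sum_of_diracs (\<lambda>i. P i \<omega>)) B)"
    using ppp B null by (auto simp: poisson_point_process_def)
  then have "prob {\<omega> \<in> space M. emeasure (sum_of_diracs (\<lambda>i. P i \<omega>)) B = of_nat 0} = 1"
    unfolding poisson_distributed_def by (simp del: of_nat_0)
  then have "AE \<omega> in M. \<omega> \<in> {\<omega> \<in> space M. emeasure (sum_of_diracs (\<lambda>i. P i \<omega>)) B = of_nat 0}"
    by (rule AE_prob_1)
  then show ?thesis
  proof eventually_elim
    case (elim \<omega>)
    then have "emeasure (count_space UNIV) {i. P i \<omega> \<in> B} = 0"
      using B S by (simp add: emeasure_sum_of_diracs)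
    then show ?case by (auto simp: emeasure_count_space split: if_splits)
  qed
qed

section \<open>The exponent of the characteristic function\<close>

lemma nn_integral_powr_lt_top:
  fixes \<beta> :: real
  shows "\<beta> > -1 \<Longrightarrow> (\<integral>\<^sup>+x. ennreal (x powr \<beta>) * indicator {0..1} x \<partial>lborel) < \<infinity>"
    and "\<beta> < -1 \<Longrightarrow> 0 < \<delta> \<Longrightarrow> (\<integral>\<^sup>+x. ennreal (x powr \<beta>) * indicator {\<delta>..} x \<partial>lborel) < \<infinity>"
  by (subst nn_integral_has_integral_lebesgue'[OF _ has_integral_powr_from_0], auto)
     (subst nn_integral_has_integral_lebesgue'[OF _ has_integral_powr_to_inf], auto)

text \<open>The contribution \<open>\<i> a y\<^sup>2 - b y\<^sup>3\<close> of a point \<open>y\<close> to the logarithm of the conditional characteristic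
  function given the points, extended by \<open>0\<close> to a continuous function on the line.\<close>

definition jump_exponent :: "real \<Rightarrow> real \<Rightarrow> real \<Rightarrow> complex" where
  "jump_exponent a b y = Complex (- (b * (max 0 y) ^ 3)) (a * (max 0 y)\<^sup>2)"

definition jump_bound :: "real \<Rightarrow> real \<Rightarrow> real" where
  "jump_bound C y = C * ((max 0 y)\<^sup>2 + (max 0 y) ^ 3)"

lemma continuous_on_jump_exponent: "continuous_on UNIV (jump_exponent a b)"
  unfolding jump_exponent_def[abs_def] Complex_eq by (intro continuous_intros)

lemma borel_measurable_jump_exponent[measurable]: "jump_exponent a b \<in> borel_measurable borel"
  by (rule borel_measurable_continuous_onI[OF continuous_on_jump_exponent])

lemma borel_measurable_jump_bound[measurable]: "jump_bound C \<in> borel_measurable borel"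
  unfolding jump_bound_def[abs_def] by measurable

lemma jump_bound_nonneg: "0 \<le> C \<Longrightarrow> 0 \<le> jump_bound C y"
  by (simp add: jump_bound_def)

lemma mono_jump_bound: "0 \<le> C \<Longrightarrow> mono (jump_bound C)"
  unfolding jump_bound_def[abs_def] by (intro monoI mult_left_mono add_mono power_mono) auto

lemma cmod_jump_exponent_le:
  assumes "\<bar>a\<bar> \<le> C" "\<bar>b\<bar> \<le> C"
  shows "cmod (jump_exponent a b y) \<le> jump_bound C y"
proof -
  have "cmod (jump_exponent a b y) \<le> \<bar>b\<bar> * (max 0 y) ^ 3 + \<bar>a\<bar> * (max 0 y)\<^sup>2"
    using cmod_le[of "jump_exponent a b y"] by (simp add: jump_exponent_def abs_mult)
  also have "\<dots> \<le> C * (max 0 y) ^ 3 + C * (max 0 y)\<^sup>2"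
    using assms by (intro add_mono mult_right_mono) auto
  finally show ?thesis by (simp add: jump_bound_def algebra_simps)
qed

lemma Re_jump_exponent_le_0: "0 \<le> b \<Longrightarrow> Re (jump_exponent a b y) \<le> 0"
  by (simp add: jump_exponent_def)

lemma jump_exponent_scale:
  assumes "0 < l"
  shows "jump_exponent a b (l * y) = jump_exponent (a * l\<^sup>2) (b * l ^ 3) y"
proof -
  have "max 0 (l * y) = l * max 0 y"
    using assms by (simp add: max_def zero_le_mult_iff)
  then show ?thesis
    by (simp add: jump_exponent_def power_mult_distrib)
qed

lemma Re_exp_jump_exponent:
  "Re (exp (jump_exponent a b y)) = exp (- (b * (max 0 y) ^ 3)) * cos (a * (max 0 y)\<^sup>2)"
  by (simp add: jump_exponent_def Re_exp)

text \<open>The intensity \<open>\<kappa> y\<^sup>-\<^sup>\<alpha>\<^sup>-\<^sup>1\<close> on the positive half-line. Here \<open>\<alpha> > 0\<close> makes the mass away from \<open>0\<close>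
  finite, and \<open>\<alpha> < 2\<close> makes \<open>y\<^sup>2\<close> integrable near \<open>0\<close>.\<close>

locale stable_jumps =
  fixes \<kappa> \<alpha> :: real
  assumes \<kappa>_pos: "0 < \<kappa>" and \<alpha>_pos: "0 < \<alpha>" and \<alpha>_less_2: "\<alpha> < 2"
begin

definition \<Lambda> :: "real measure" where
  "\<Lambda> = density lborel (\<lambda>y. ennreal (\<kappa> * y powr (- \<alpha> - 1)) * indicator {0<..} y)"

lemma sets_\<Lambda>[simp, measurable_cong]: "sets \<Lambda> = sets borel"
  by (simp add: \<Lambda>_def)

lemma \<Lambda>_eq: "\<Lambda> = density lborel (\<lambda>y. ennreal (\<kappa> * y powr (- \<alpha> - 1) * indicator {0<..} y))"
  unfolding \<Lambda>_def by (intro arg_cong[where f="density lborel"] ext) (auto simp: indicator_def)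

lemma emeasure_\<Lambda>_atMost_0: "emeasure \<Lambda> {..0} = 0"
  unfolding \<Lambda>_def by (subst emeasure_density) (auto simp: nn_integral_0_iff_AE indicator_def)

lemma emeasure_\<Lambda>_atLeast:
  assumes "0 < \<delta>"
  shows "emeasure \<Lambda> {\<delta>..} \<noteq> \<infinity>"
proof -
  have "emeasure \<Lambda> {\<delta>..} = (\<integral>\<^sup>+y. ennreal \<kappa> * (ennreal (y powr (- \<alpha> - 1)) * indicator {\<delta>..} y) \<partial>lborel)"
    unfolding \<Lambda>_def using assms \<kappa>_pos
    by (subst emeasure_density) (auto intro!: nn_integral_cong simp: indicator_def ennreal_mult)
  also have "\<dots> = ennreal \<kappa> * (\<integral>\<^sup>+y. ennreal (y powr (- \<alpha> - 1)) * indicator {\<delta>..} y \<partial>lborel)"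
    by (rule nn_integral_cmult) measurable
  also have "\<dots> < \<infinity>"
    using nn_integral_powr_lt_top(2)[of "- \<alpha> - 1" \<delta>] assms \<alpha>_pos by (simp add: ennreal_mult_less_top)
  finally show ?thesis by simp
qed

text \<open>Near \<open>0\<close> the integrand is of order \<open>y\<^sup>2\<close> times the intensity, that is \<open>y\<^sup>1\<^sup>-\<^sup>\<alpha>\<close>; on \<open>{1..}\<close> it is at
  most the intensity.\<close>

lemma integrable_min_jump_bound:
  assumes "0 \<le> C"
  shows "integrable \<Lambda> (\<lambda>y. min 1 (jump_bound C y))"
proof (rule integrableI_nonneg)
  have pw: "ennreal (\<kappa> * y powr (- \<alpha> - 1)) * indicator {0<..} y * ennreal (min 1 (jump_bound C y))
        \<le> ennreal (2 * C * \<kappa>) * (ennreal (y powr (1 - \<alpha>)) * indicator {0..1} y)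
          + ennreal \<kappa> * (ennreal (y powr (- \<alpha> - 1)) * indicator {1..} y)" for y
  proof -
    consider "y \<le> 0" | "0 < y" "y \<le> 1" | "1 < y" by linarith
    then show ?thesis
    proof cases
      case 2
      have "y powr (- \<alpha> - 1) * y\<^sup>2 = y powr (1 - \<alpha>)"
        using 2 powr_add[of y "- \<alpha> - 1" 2] by simp
      moreover have "jump_bound C y \<le> 2 * C * y\<^sup>2"
      proof -
        have "y ^ 3 \<le> y ^ 2" using 2 by (intro power_decreasing) auto
        then have "C * (y\<^sup>2 + y ^ 3) \<le> C * (2 * y\<^sup>2)" using assms by (intro mult_left_mono) auto
        then show ?thesis using 2 by (simp add: jump_bound_def)
      qed
      ultimately have "\<kappa> * y powr (- \<alpha> - 1) * min 1 (jump_bound C y) \<le> 2 * C * \<kappa> * y powr (1 - \<alpha>)"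
        using \<kappa>_pos mult_left_mono[of "min 1 (jump_bound C y)" "2 * C * y\<^sup>2" "\<kappa> * y powr (- \<alpha> - 1)"]
        by (simp add: mult_ac)
      then have "ennreal (\<kappa> * y powr (- \<alpha> - 1)) * ennreal (min 1 (jump_bound C y))
          \<le> ennreal (2 * C * \<kappa>) * ennreal (y powr (1 - \<alpha>))"
        using assms \<kappa>_pos jump_bound_nonneg[OF assms] by (simp add: ennreal_mult[symmetric] ennreal_leI)
      then show ?thesis using 2 by (simp add: add_increasing2)
    next
      case 3
      have "\<kappa> * y powr (- \<alpha> - 1) * min 1 (jump_bound C y) \<le> \<kappa> * y powr (- \<alpha> - 1) * 1"
        using \<kappa>_pos by (intro mult_left_mono) auto
      then have "ennreal (\<kappa> * y powr (- \<alpha> - 1)) * ennreal (min 1 (jump_bound C y))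
          \<le> ennreal \<kappa> * ennreal (y powr (- \<alpha> - 1))"
        using assms \<kappa>_pos jump_bound_nonneg[OF assms] by (simp add: ennreal_mult[symmetric] ennreal_leI)
      then show ?thesis using 3 by simp
    qed simp
  qed
  have "(\<integral>\<^sup>+y. ennreal (min 1 (jump_bound C y)) \<partial>\<Lambda>)
      = (\<integral>\<^sup>+y. ennreal (\<kappa> * y powr (- \<alpha> - 1)) * indicator {0<..} y * ennreal (min 1 (jump_bound C y)) \<partial>lborel)"
    unfolding \<Lambda>_def by (rule nn_integral_density) measurable
  also have "\<dots> \<le> (\<integral>\<^sup>+y. ennreal (2 * C * \<kappa>) * (ennreal (y powr (1 - \<alpha>)) * indicator {0..1} y)
          + ennreal \<kappa> * (ennreal (y powr (- \<alpha> - 1)) * indicator {1..} y) \<partial>lborel)"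
    by (intro nn_integral_mono pw)
  also have "\<dots> = ennreal (2 * C * \<kappa>) * (\<integral>\<^sup>+y. ennreal (y powr (1 - \<alpha>)) * indicator {0..1} y \<partial>lborel)
          + ennreal \<kappa> * (\<integral>\<^sup>+y. ennreal (y powr (- \<alpha> - 1)) * indicator {1..} y \<partial>lborel)"
    by (subst nn_integral_add) (auto simp: nn_integral_cmult)
  also have "\<dots> < \<infinity>"
    using nn_integral_powr_lt_top(1)[of "1 - \<alpha>"] nn_integral_powr_lt_top(2)[of "- \<alpha> - 1" 1] \<alpha>_pos \<alpha>_less_2
    by (simp add: ennreal_mult_less_top)
  finally show "(\<integral>\<^sup>+y. ennreal (min 1 (jump_bound C y)) \<partial>\<Lambda>) < \<infinity>" .
qed (auto simp: jump_bound_nonneg assms)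

text \<open>Homogeneity of the intensity, the source of all scaling properties below.\<close>

lemma integral_\<Lambda>_scale:
  fixes F :: "real \<Rightarrow> 'b::{banach, second_countable_topology}"
  assumes [measurable]: "F \<in> borel_measurable borel" and l: "0 < l"
  shows "(\<integral>y. F (l * y) \<partial>\<Lambda>) = l powr \<alpha> *\<^sub>R (\<integral>y. F y \<partial>\<Lambda>)"
proof -
  let ?w = "\<lambda>y. \<kappa> * y powr (- \<alpha> - 1) * indicator {0<..} y :: real"
  have w: "l * ?w (l * y) = l powr (- \<alpha>) * ?w y" for y
  proof (cases "0 < y")
    case True
    have "l * l powr (- \<alpha> - 1) = l powr (- \<alpha>)"
      using l powr_add[of l 1 "- \<alpha> - 1"] by simp
    then show ?thesis using True l by (simp add: powr_mult mult_ac)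
  qed (use l in \<open>simp add: indicator_def zero_less_mult_iff\<close>)
  have dens: "(\<integral>y. G y \<partial>\<Lambda>) = (\<integral>y. ?w y *\<^sub>R G y \<partial>lborel)"
    if [measurable]: "G \<in> borel_measurable borel" for G :: "real \<Rightarrow> 'b"
    unfolding \<Lambda>_eq using \<kappa>_pos by (intro integral_density) auto
  have "(\<integral>y. F y \<partial>\<Lambda>) = \<bar>l\<bar> *\<^sub>R (\<integral>y. ?w (0 + l * y) *\<^sub>R F (0 + l * y) \<partial>lborel)"
    unfolding dens[OF assms(1)] using l by (intro lborel_integral_real_affine) simp
  also have "\<dots> = (\<integral>y. (l * ?w (l * y)) *\<^sub>R F (l * y) \<partial>lborel)"
    using l by (subst integral_scaleR_right[symmetric]) simp_all
  also have "\<dots> = l powr (- \<alpha>) *\<^sub>R (\<integral>y. F (l * y) \<partial>\<Lambda>)"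
    unfolding w by (subst dens) (simp_all flip: scaleR_scaleR)
  finally have "l powr \<alpha> *\<^sub>R (\<integral>y. F y \<partial>\<Lambda>) = (l powr \<alpha> * l powr (- \<alpha>)) *\<^sub>R (\<integral>y. F (l * y) \<partial>\<Lambda>)"
    by simp
  also have "l powr \<alpha> * l powr (- \<alpha>) = 1"
    using l by (simp add: powr_add[symmetric])
  finally show ?thesis by simp
qed

lemma integral_\<Lambda>_pos:
  fixes F :: "real \<Rightarrow> real"
  assumes int: "integrable \<Lambda> F" and nonneg: "\<And>y. 0 \<le> F y" and pos: "\<And>y. 0 < y \<Longrightarrow> y < 1 \<Longrightarrow> 0 < F y"
  shows "0 < (\<integral>y. F y \<partial>\<Lambda>)"
proof (rule ccontr)
  assume "\<not> 0 < (\<integral>y. F y \<partial>\<Lambda>)"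
  moreover have "0 \<le> (\<integral>y. F y \<partial>\<Lambda>)"
    by (intro integral_nonneg_AE AE_I2 nonneg)
  ultimately have "(\<integral>y. F y \<partial>\<Lambda>) = 0"
    by linarith
  then have "AE y in \<Lambda>. F y = 0"
    using int nonneg by (subst (asm) integral_nonneg_eq_0_iff_AE) auto
  then have "AE y in lborel. 0 < ennreal (\<kappa> * y powr (- \<alpha> - 1) * indicator {0<..} y) \<longrightarrow> F y = 0"
    unfolding \<Lambda>_eq by (subst (asm) AE_density) auto
  then have "AE y in lborel. y \<notin> {0<..<1::real}"
  proof eventually_elim
    case (elim y)
    then show ?case using pos[of y] \<kappa>_pos by (auto simp: ennreal_less_zero_iff)
  qed
  then have "emeasure lborel {0<..<1::real} = 0"
    by (subst (asm) AE_iff_measurable[of "{0<..<1::real}"]) auto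
  then show False by simp
qed

definition levy_exponent :: "real \<Rightarrow> real \<Rightarrow> complex" where
  "levy_exponent a b = (CLINT y|\<Lambda>. exp (jump_exponent a b y) - 1)"

lemma cmod_exp_jump_exponent_minus_1_le:
  assumes "\<bar>a\<bar> \<le> C" "\<bar>b\<bar> \<le> C" "0 \<le> b"
  shows "cmod (exp (jump_exponent a b y) - 1) \<le> 2 * min 1 (jump_bound C y)"
  using cmod_exp_minus_1_le[OF Re_jump_exponent_le_0[OF \<open>0 \<le> b\<close>, of a y]] cmod_jump_exponent_le[OF assms(1,2), of y]
  by linarith

lemma integrable_exp_jump_exponent:
  assumes "0 \<le> b"
  shows "integrable \<Lambda> (\<lambda>y. exp (jump_exponent a b y) - 1)"
proof (rule Bochner_Integration.integrable_bound)
  let ?C = "\<bar>a\<bar> + b"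
  show "integrable \<Lambda> (\<lambda>y. 2 * min 1 (jump_bound ?C y))"
    using assms by (intro integrable_mult_right integrable_min_jump_bound) simp
  show "AE y in \<Lambda>. norm (exp (jump_exponent a b y) - 1) \<le> norm (2 * min 1 (jump_bound ?C y))"
    using assms
    by (intro AE_I2 order.trans[OF cmod_exp_jump_exponent_minus_1_le[of a ?C b]]) auto
qed measurable

lemma levy_exponent_0: "levy_exponent 0 0 = 0"
  by (simp add: levy_exponent_def jump_exponent_def Complex_eq)

lemma levy_exponent_scale:
  "0 < l \<Longrightarrow> levy_exponent (a * l\<^sup>2) (b * l ^ 3) = l powr \<alpha> *\<^sub>R levy_exponent a b"
  unfolding levy_exponent_def
  using integral_\<Lambda>_scale[of "\<lambda>y. exp (jump_exponent a b y) - 1" l] by (simp add: jump_exponent_scale)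

lemma tendsto_levy_exponent:
  assumes a: "A \<longlonglongrightarrow> a" and b: "B \<longlonglongrightarrow> b" and B: "\<And>n::nat. 0 \<le> B n"
  shows "(\<lambda>n. levy_exponent (A n) (B n)) \<longlonglongrightarrow> levy_exponent a b"
proof -
  obtain C1 where C1: "\<And>n. norm (A n) \<le> C1"
    using convergent_imp_Bseq[OF convergentI[OF a]] by (auto simp: Bseq_def)
  obtain C2 where C2: "\<And>n. norm (B n) \<le> C2"
    using convergent_imp_Bseq[OF convergentI[OF b]] by (auto simp: Bseq_def)
  define C where "C = max C1 C2"
  have C: "\<bar>A n\<bar> \<le> C" "\<bar>B n\<bar> \<le> C" for n
    using C1[of n] C2[of n] by (auto simp: C_def)
  have "0 \<le> C" using C(1)[of 0] by simp
  show ?thesis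
    unfolding levy_exponent_def
  proof (rule integral_dominated_convergence[where w="\<lambda>y. 2 * min 1 (jump_bound C y)"])
    show "integrable \<Lambda> (\<lambda>y. 2 * min 1 (jump_bound C y))"
      using \<open>0 \<le> C\<close> by (intro integrable_mult_right integrable_min_jump_bound)
    show "AE y in \<Lambda>. (\<lambda>n. exp (jump_exponent (A n) (B n) y) - 1) \<longlonglongrightarrow> exp (jump_exponent a b y) - 1"
      unfolding jump_exponent_def by (intro AE_I2 tendsto_intros a b)
    show "AE y in \<Lambda>. norm (exp (jump_exponent (A n) (B n) y) - 1) \<le> 2 * min 1 (jump_bound C y)" for n
      by (intro AE_I2 cmod_exp_jump_exponent_minus_1_le C B)
  qed measurable
qed

lemma
  assumes "0 \<le> b"
  shows neg_Re_levy_exponent: "- Re (levy_exponent a b) = (\<integral>y. 1 - exp (- (b * (max 0 y) ^ 3)) * cos (a * (max 0 y)\<^sup>2) \<partial>\<Lambda>)"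
    and integrable_neg_Re_levy_exponent: "integrable \<Lambda> (\<lambda>y. 1 - exp (- (b * (max 0 y) ^ 3)) * cos (a * (max 0 y)\<^sup>2))"
proof -
  have i: "integrable \<Lambda> (\<lambda>y. - Re (exp (jump_exponent a b y) - 1))"
    by (intro Bochner_Integration.integrable_minus integrable_Re integrable_exp_jump_exponent assms)
  then show "integrable \<Lambda> (\<lambda>y. 1 - exp (- (b * (max 0 y) ^ 3)) * cos (a * (max 0 y)\<^sup>2))"
    by (simp add: Re_exp_jump_exponent)
  have "- Re (levy_exponent a b) = (\<integral>y. - Re (exp (jump_exponent a b y) - 1) \<partial>\<Lambda>)"
    unfolding levy_exponent_def using integrable_exp_jump_exponent[OF assms, of a]
    by (simp only: Bochner_Integration.integral_minus integral_Re)
  then show "- Re (levy_exponent a b) = (\<integral>y. 1 - exp (- (b * (max 0 y) ^ 3)) * cos (a * (max 0 y)\<^sup>2) \<partial>\<Lambda>)"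
    by (simp add: Re_exp_jump_exponent)
qed

text \<open>The pointwise bounds \<open>1 - e c \<ge> (1 - c)/2\<close> and \<open>1 - e c \<ge> 1 - e\<close>, for \<open>0 \<le> e \<le> 1\<close> and \<open>\<bar>c\<bar> \<le> 1\<close>,
  separate the two variables, and scaling reduces each of them to the value at \<open>1\<close>.\<close>

lemma levy_exponent_lower_bound:
  obtains c where "0 < c"
    "\<And>a b. 0 \<le> b \<Longrightarrow> c * (\<bar>a\<bar> powr (\<alpha> / 2) + b powr (\<alpha> / 3)) \<le> - Re (levy_exponent a b)"
proof
  define K1 where "K1 = - Re (levy_exponent 1 0)"
  define K2 where "K2 = - Re (levy_exponent 0 1)"
  have K1: "0 < K1"
    unfolding K1_def neg_Re_levy_exponent[OF order.refl]
  proof (rule integral_\<Lambda>_pos[OF integrable_neg_Re_levy_exponent[OF order.refl]])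
    fix y :: real assume y: "0 < y" "y < 1"
    then have "0 < y\<^sup>2" "y\<^sup>2 < 1" by (auto simp: power_less_one_iff abs_square_less_1)
    then have "cos (y\<^sup>2) < cos 0" using pi_gt3 by (intro cos_monotone_0_pi) auto
    then show "0 < 1 - exp (- (0 * (max 0 y) ^ 3)) * cos (1 * (max 0 y)\<^sup>2)" using y by simp
  qed simp
  have K2: "0 < K2"
    unfolding K2_def neg_Re_levy_exponent[OF zero_le_one]
    by (rule integral_\<Lambda>_pos[OF integrable_neg_Re_levy_exponent[OF zero_le_one]]) auto
  show "0 < min K1 K2 / 4" using K1 K2 by simp
  fix a b :: real assume b: "0 \<le> b"
  have 1: "\<bar>a\<bar> powr (\<alpha> / 2) * K1 / 2 \<le> - Re (levy_exponent a b)"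
  proof -
    have "\<bar>a\<bar> powr (\<alpha> / 2) * K1 = - Re (levy_exponent \<bar>a\<bar> 0)"
    proof (cases "a = 0")
      case False
      then have "levy_exponent \<bar>a\<bar> 0 = (\<bar>a\<bar> powr (1 / 2)) powr \<alpha> *\<^sub>R levy_exponent 1 0"
        using levy_exponent_scale[of "\<bar>a\<bar> powr (1/2)" 1 0] by (simp add: powr_half_sqrt)
      then show ?thesis by (simp add: K1_def powr_powr)
    qed (simp add: levy_exponent_0)
    also have "\<dots> = (\<integral>y. 1 - cos (a * (max 0 y)\<^sup>2) \<partial>\<Lambda>)"
      by (subst neg_Re_levy_exponent) (auto simp: abs_if)
    finally have "\<bar>a\<bar> powr (\<alpha> / 2) * K1 / 2 = (\<integral>y. (1 - cos (a * (max 0 y)\<^sup>2)) / 2 \<partial>\<Lambda>)"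
      by simp
    also have "\<dots> \<le> - Re (levy_exponent a b)"
      unfolding neg_Re_levy_exponent[OF b]
    proof (rule integral_mono)
      show "integrable \<Lambda> (\<lambda>y. (1 - cos (a * (max 0 y)\<^sup>2)) / 2)"
        using integrable_neg_Re_levy_exponent[of 0 a] by simp
      show "integrable \<Lambda> (\<lambda>y. 1 - exp (- (b * (max 0 y) ^ 3)) * cos (a * (max 0 y)\<^sup>2))"
        using b by (rule integrable_neg_Re_levy_exponent)
      fix y :: real
      have le: "(1 - c) / 2 \<le> 1 - e * c" if "0 \<le> e" "e \<le> 1" "\<bar>c\<bar> \<le> 1" for c e :: real
      proof (cases "0 \<le> c")
        case True
        then have "e * c \<le> 1 * c" using that by (intro mult_right_mono) auto
        moreover have "c \<le> 1" using that by simp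
        ultimately show ?thesis by (simp add: field_simps)
      next
        case False
        then have "e * c \<le> 0" using that by (intro mult_nonneg_nonpos) auto
        moreover have "- 1 \<le> c" using that by simp
        ultimately show ?thesis by (simp add: field_simps)
      qed
      show "(1 - cos (a * (max 0 y)\<^sup>2)) / 2 \<le> 1 - exp (- (b * (max 0 y) ^ 3)) * cos (a * (max 0 y)\<^sup>2)"
        using b by (intro le) auto
    qed
    finally show ?thesis .
  qed
  have 2: "b powr (\<alpha> / 3) * K2 \<le> - Re (levy_exponent a b)"
  proof -
    have "b powr (\<alpha> / 3) * K2 = - Re (levy_exponent 0 b)"
    proof (cases "b = 0")
      case False
      then have "(b powr (1 / 3)) ^ 3 = b"
        using b by (simp flip: powr_numeral add: powr_powr)
      then have "levy_exponent 0 b = (b powr (1 / 3)) powr \<alpha> *\<^sub>R levy_exponent 0 1"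
        using levy_exponent_scale[of "b powr (1/3)" 0 1] b False by simp
      then show ?thesis by (simp add: K2_def powr_powr)
    qed (simp add: levy_exponent_0)
    also have "\<dots> = (\<integral>y. 1 - exp (- (b * (max 0 y) ^ 3)) \<partial>\<Lambda>)"
      using b by (subst neg_Re_levy_exponent) auto
    also have "\<dots> \<le> - Re (levy_exponent a b)"
      unfolding neg_Re_levy_exponent[OF b]
    proof (rule integral_mono)
      show "integrable \<Lambda> (\<lambda>y. 1 - exp (- (b * (max 0 y) ^ 3)))"
        using integrable_neg_Re_levy_exponent[OF b, of 0] by simp
      show "integrable \<Lambda> (\<lambda>y. 1 - exp (- (b * (max 0 y) ^ 3)) * cos (a * (max 0 y)\<^sup>2))"
        using b by (rule integrable_neg_Re_levy_exponent)
      show "1 - exp (- (b * (max 0 y) ^ 3)) \<le> 1 - exp (- (b * (max 0 y) ^ 3)) * cos (a * (max 0 y)\<^sup>2)" for y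
        by simp
    qed
    finally show ?thesis .
  qed
  have "min K1 K2 * \<bar>a\<bar> powr (\<alpha> / 2) \<le> K1 * \<bar>a\<bar> powr (\<alpha> / 2)"
    "min K1 K2 * b powr (\<alpha> / 3) \<le> K2 * b powr (\<alpha> / 3)"
    "0 \<le> K2 * b powr (\<alpha> / 3)"
    using K2 by (auto intro: mult_right_mono)
  then show "min K1 K2 / 4 * (\<bar>a\<bar> powr (\<alpha> / 2) + b powr (\<alpha> / 3)) \<le> - Re (levy_exponent a b)"
    using 1 2 by (simp add: algebra_simps)
qed

end

section \<open>Stretched exponential decay\<close>

lemma power_div_fact_le_exp:
  fixes x :: real
  assumes "0 \<le> x"
  shows "x ^ m / fact m \<le> exp x"
proof -
  have "(\<Sum>n\<in>{m}. x ^ n /\<^sub>R fact n) \<le> (\<Sum>n. x ^ n /\<^sub>R fact n)"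
    using assms by (intro sum_le_suminf summable_exp_generic) auto
  then show ?thesis by (simp add: exp_def field_simps)
qed

lemma power_times_stretched_exp_bounded:
  assumes "0 < c" "0 < \<beta>"
  shows "\<exists>C. \<forall>x::real. (1 + \<bar>x\<bar>) ^ n * exp (- (c * \<bar>x\<bar> powr \<beta>)) \<le> C"
proof -
  \<comment> \<open>Then \<open>(\<bar>x\<bar> powr \<beta>) ^ m\<close>, a multiple of a term of the exponential series, dominates \<open>\<bar>x\<bar> ^ n\<close> for \<open>\<bar>x\<bar> \<ge> 1\<close>.\<close>
  obtain m :: nat where m: "real n / \<beta> \<le> real m" using real_arch_simple by blast
  have "(1 + \<bar>x\<bar>) ^ n * exp (- (c * \<bar>x\<bar> powr \<beta>)) \<le> 2 ^ n * (1 + fact m / c ^ m)" for x :: real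
  proof (cases "\<bar>x\<bar> \<le> 1")
    case True
    then have "(1 + \<bar>x\<bar>) ^ n * exp (- (c * \<bar>x\<bar> powr \<beta>)) \<le> 2 ^ n * 1"
      using assms by (intro mult_mono power_mono) auto
    also have "\<dots> \<le> 2 ^ n * (1 + fact m / c ^ m)"
      using assms by (intro mult_left_mono) auto
    finally show ?thesis .
  next
    case False
    define u where "u = \<bar>x\<bar>"
    have u: "1 < u" using False by (simp add: u_def)
    have "(c * u powr \<beta>) ^ m / fact m \<le> exp (c * u powr \<beta>)"
      using assms by (intro power_div_fact_le_exp) simp
    then have "(u powr \<beta>) ^ m * exp (- (c * u powr \<beta>)) \<le> fact m / c ^ m"
      using assms by (simp add: field_simps exp_minus power_mult_distrib)
    moreover have "u ^ n \<le> (u powr \<beta>) ^ m"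
    proof -
      have "u ^ n = u powr real n" using u by (simp add: powr_realpow)
      also have "\<dots> \<le> u powr (\<beta> * real m)"
        using m assms u by (intro powr_mono) (auto simp: field_simps)
      also have "\<dots> = (u powr \<beta>) ^ m" using u by (simp add: powr_powr[symmetric] powr_realpow)
      finally show ?thesis .
    qed
    ultimately have "u ^ n * exp (- (c * u powr \<beta>)) \<le> fact m / c ^ m"
      by (meson exp_ge_zero mult_right_mono order.trans)
    then have "2 ^ n * (u ^ n * exp (- (c * u powr \<beta>))) \<le> 2 ^ n * (1 + fact m / c ^ m)"
      by (intro mult_left_mono) auto
    moreover have "(1 + u) ^ n * exp (- (c * u powr \<beta>)) \<le> (2 * u) ^ n * exp (- (c * u powr \<beta>))"
      using u by (intro mult_right_mono power_mono) auto
    moreover have "(2 * u) ^ n * exp (- (c * u powr \<beta>)) = 2 ^ n * (u ^ n * exp (- (c * u powr \<beta>)))"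
      by (simp add: power_mult_distrib)
    ultimately show ?thesis unfolding u_def by linarith
  qed
  then show ?thesis by blast
qed

lemma integrable_power_times_stretched_exp:
  assumes "0 < c" "0 < \<beta>"
  shows "integrable lborel (\<lambda>x::real. (1 + \<bar>x\<bar>) ^ n * exp (- (c * \<bar>x\<bar> powr \<beta>)))"
proof -
  obtain C where C: "\<And>x::real. (1 + \<bar>x\<bar>) ^ (n + 2) * exp (- (c * \<bar>x\<bar> powr \<beta>)) \<le> C"
    using power_times_stretched_exp_bounded[OF assms] by blast
  have i: "integrable lborel (\<lambda>x::real. C * inverse (1 + x\<^sup>2))"
    using integrable_inverse_1_plus_square by (simp add: set_integrable_def)
  show ?thesis
  proof (rule Bochner_Integration.integrable_bound[OF i])
    show "AE x in lborel. norm ((1 + \<bar>x\<bar>) ^ n * exp (- (c * \<bar>x\<bar> powr \<beta>))) \<le> norm (C * inverse (1 + x\<^sup>2))"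
    proof (intro AE_I2)
      fix x :: real
      have pos: "0 < 1 + x\<^sup>2" by (simp add: add_pos_nonneg)
      have "(1 + x\<^sup>2) * ((1 + \<bar>x\<bar>) ^ n * exp (- (c * \<bar>x\<bar> powr \<beta>)))
          \<le> (1 + \<bar>x\<bar>)\<^sup>2 * ((1 + \<bar>x\<bar>) ^ n * exp (- (c * \<bar>x\<bar> powr \<beta>)))"
        by (intro mult_right_mono) (auto simp: power2_eq_square algebra_simps)
      also have "\<dots> = (1 + \<bar>x\<bar>) ^ (n + 2) * exp (- (c * \<bar>x\<bar> powr \<beta>))"
        by (simp only: power_add mult_ac)
      also have "\<dots> \<le> C" by (rule C)
      finally have "(1 + \<bar>x\<bar>) ^ n * exp (- (c * \<bar>x\<bar> powr \<beta>)) \<le> C * inverse (1 + x\<^sup>2)"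
        using pos by (simp add: field_simps)
      then show "norm ((1 + \<bar>x\<bar>) ^ n * exp (- (c * \<bar>x\<bar> powr \<beta>))) \<le> norm (C * inverse (1 + x\<^sup>2))"
        by simp
    qed
  qed measurable
qed

text \<open>As \<open>norm w\<close> is at most the product of the factors \<open>1 + \<bar>w \<bullet> b\<bar>\<close>, every moment is dominated by a
  product of one-dimensional integrands.\<close>

lemma rapidly_decaying_of_stretched_exp_bound:
  fixes h :: "'a::euclidean_space \<Rightarrow> complex"
  assumes [measurable]: "h \<in> borel_measurable borel" and "0 < c" and \<beta>: "\<And>b. b \<in> Basis \<Longrightarrow> 0 < \<beta> b"
    and h: "\<And>w. cmod (h w) \<le> exp (- (c * (\<Sum>b\<in>Basis. \<bar>w \<bullet> b\<bar> powr \<beta> b)))"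
  shows "rapidly_decaying h"
  unfolding rapidly_decaying_def
proof (intro conjI allI)
  fix k
  let ?f = "\<lambda>b x. (1 + \<bar>x\<bar>) ^ k * exp (- (c * \<bar>x\<bar> powr \<beta> b))"
  have i: "integrable lborel (\<lambda>w::'a. \<Prod>b\<in>Basis. ?f b (w \<bullet> b))"
    by (intro lborel_integrable_prod_Basis integrable_power_times_stretched_exp assms)
  show "integrable lborel (\<lambda>w. norm w ^ k * cmod (h w))"
  proof (rule Bochner_Integration.integrable_bound[OF i])
    show "AE w in lborel. norm (norm w ^ k * cmod (h w)) \<le> norm (\<Prod>b\<in>Basis. ?f b (w \<bullet> b))"
    proof (intro AE_I2)
      fix w :: 'a
      have "norm w \<le> (\<Sum>b\<in>Basis. \<bar>w \<bullet> b\<bar>)" by (rule norm_le_l1)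
      also have "\<dots> \<le> (\<Prod>b\<in>Basis. 1 + \<bar>w \<bullet> b\<bar>)" by (rule sum_le_prod) simp
      finally have "norm w ^ k * cmod (h w)
          \<le> (\<Prod>b\<in>Basis. 1 + \<bar>w \<bullet> b\<bar>) ^ k * exp (- (c * (\<Sum>b\<in>Basis. \<bar>w \<bullet> b\<bar> powr \<beta> b)))"
        by (intro mult_mono power_mono h) (auto intro!: zero_le_power prod_nonneg)
      also have "\<dots> = (\<Prod>b\<in>Basis. ?f b (w \<bullet> b))"
        by (simp add: prod_power_distrib prod.distrib sum_distrib_left exp_sum sum_negf[symmetric])
      finally show "norm (norm w ^ k * cmod (h w)) \<le> norm (\<Prod>b\<in>Basis. ?f b (w \<bullet> b))"
        by simp
    qed
  qed measurable
qed measurable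

section \<open>Convolution powers and full distributions\<close>

lemma char_fun_convolution:
  assumes "prob_space \<mu>" "prob_space \<nu>"
    and [measurable_cong]: "sets \<mu> = sets borel" "sets \<nu> = sets borel"
  shows "char_fun (\<mu> \<star> \<nu>) t = char_fun \<mu> t * char_fun \<nu> t"
proof -
  interpret \<mu>: prob_space \<mu> by fact
  interpret \<nu>: prob_space \<nu> by fact
  interpret pair_prob_space \<mu> \<nu> ..
  have i: "integrable (\<mu> \<Otimes>\<^sub>M \<nu>) (\<lambda>(x, y). iexp (t \<bullet> (x + y)))"
    by (rule P.integrable_const_bound[where B=1]) auto
  have "char_fun (\<mu> \<star> \<nu>) t = (CLINT p|\<mu> \<Otimes>\<^sub>M \<nu>. case p of (x, y) \<Rightarrow> iexp (t \<bullet> (x + y)))"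
    unfolding char_fun_def convolution_def by (subst integral_distr) (auto simp: case_prod_unfold)
  also have "\<dots> = (CLINT x|\<mu>. CLINT y|\<nu>. iexp (t \<bullet> (x + y)))"
    by (rule integral_fst[OF i, symmetric])
  also have "\<dots> = char_fun \<mu> t * char_fun \<nu> t"
    by (simp add: char_fun_def inner_add_right distrib_left exp_add)
  finally show ?thesis .
qed

lemma
  assumes "prob_space \<rho>" and S[measurable_cong]: "sets \<rho> = sets borel"
  shows prob_space_convolution_power: "prob_space (convolution_power \<rho> n)"
    and sets_convolution_power: "sets (convolution_power \<rho> n) = sets borel"
    and char_fun_convolution_power: "char_fun (convolution_power \<rho> n) t = char_fun \<rho> t ^ n"
proof (induction n)
  case 0
  { case 1 show ?case by (simp add: prob_space_return) }
  { case 2 show ?case by simp }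
  { case 3 show ?case by (simp add: char_fun_def integral_return) }
next
  case (Suc n)
  interpret \<rho>: prob_space \<rho> by fact
  interpret c: prob_space "convolution_power \<rho> n" by (rule Suc.IH(1))
  interpret pair_prob_space \<rho> "convolution_power \<rho> n" ..
  note [measurable_cong] = Suc.IH(2)
  { case 1 show ?case
      by (simp add: convolution_def) (rule prob_space_distr, measurable) }
  { case 2 show ?case by simp }
  { case 3 show ?case using char_fun_convolution[OF assms(1) Suc.IH(1) S Suc.IH(2)] Suc.IH(3) by simp }
qed

text \<open>A proper affine subspace lies in a hyperplane, which is a Lebesgue null set.\<close>

lemma full_distribution_density_lborel:
  fixes f :: "'a::euclidean_space \<Rightarrow> ennreal"
  assumes "prob_space (density lborel f)" and f: "f \<in> borel_measurable borel"
  shows "full_distribution (density lborel f)"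
  unfolding full_distribution_def
proof
  interpret prob_space "density lborel f" by fact
  assume "\<exists>S. affine S \<and> S \<noteq> UNIV \<and> (AE x in density lborel f. x \<in> S)"
  then obtain S where S: "affine S" "S \<noteq> UNIV" "AE x in density lborel f. x \<in> S" by blast
  have "aff_dim S \<noteq> DIM('a)"
    using S(1,2) by (simp add: aff_dim_eq_full hull_same)
  then have "aff_dim S < DIM('a)"
    using aff_dim_le_DIM[of S] by linarith
  then obtain a b where ab: "a \<noteq> 0" "S \<subseteq> {x. a \<bullet> x = b}"
    by (rule aff_lowdim_subset_hyperplane)
  have "negligible {x. a \<bullet> x = b}"
    using ab by (intro negligible_hyperplane) simp
  moreover have "{x. a \<bullet> x = b} \<in> sets borel"
    using closed_hyperplane[of a b] by (rule borel_closed)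
  ultimately have "{x. a \<bullet> x = b} \<in> null_sets lborel"
    by (simp add: negligible_iff_null_sets null_sets_completion_iff)
  then have "AE x in lborel. x \<notin> {x. a \<bullet> x = b}"
    by (rule AE_not_in)
  then have "AE x in density lborel f. x \<notin> {x. a \<bullet> x = b}"
    using f by (subst AE_density) auto
  with S(3) have "AE x in density lborel f. False"
    by eventually_elim (use ab in auto)
  then show False by simp
qed

section \<open>Diagonal matrices and vectors in the plane\<close>

lemma diag_eq_scaleR:
  "vector [vector [p, 0], vector [0, q]]
     = p *\<^sub>R (vector [vector [1, 0], vector [0, 0]] :: real^2^2) + q *\<^sub>R vector [vector [0, 0], vector [0, 1]]"
  by (simp add: vec_eq_iff forall_2)

lemma diag_matrix_power:
  "(((**) (vector [vector [p, 0], vector [0, q]] :: real^2^2)) ^^ k) (mat 1)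
     = vector [vector [p ^ k, 0], vector [0, q ^ k]]"
proof (induction k)
  case 0
  show ?case by (simp add: vec_eq_iff forall_2 mat_def)
next
  case (Suc k)
  then show ?case by (simp add: vec_eq_iff forall_2 matrix_matrix_mult_def sum_2)
qed

lemma matrix_exp_diag:
  "matrix_exp (vector [vector [p, 0], vector [0, q]] :: real^2^2) = vector [vector [exp p, 0], vector [0, exp q]]"
proof -
  have "(\<lambda>k. (p ^ k /\<^sub>R fact k) *\<^sub>R (vector [vector [1, 0], vector [0, 0]] :: real^2^2)
           + (q ^ k /\<^sub>R fact k) *\<^sub>R vector [vector [0, 0], vector [0, 1]])
        sums (exp p *\<^sub>R vector [vector [1, 0], vector [0, 0]] + exp q *\<^sub>R vector [vector [0, 0], vector [0, 1]])"
    by (intro sums_add sums_scaleR_left exp_converges)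
  then have "(\<lambda>k. (1 / fact k) *\<^sub>R (((**) (vector [vector [p, 0], vector [0, q]] :: real^2^2)) ^^ k) (mat 1))
        sums vector [vector [exp p, 0], vector [0, exp q]]"
    unfolding diag_matrix_power diag_eq_scaleR[of "exp p"] diag_eq_scaleR[of "p ^ _"]
    by (simp add: scaleR_add_right divide_inverse mult.commute)
  then show ?thesis
    unfolding matrix_exp_def by (rule sums_unique[symmetric])
qed

lemma matrix_powr_diag:
  assumes "0 < a"
  shows "matrix_powr a (vector [vector [p, 0], vector [0, q]] :: real^2^2)
           = vector [vector [a powr p, 0], vector [0, a powr q]]"
proof -
  have "ln a *\<^sub>R (vector [vector [p, 0], vector [0, q]] :: real^2^2) = vector [vector [p * ln a, 0], vector [0, q * ln a]]"
    by (simp add: vec_eq_iff forall_2)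
  then show ?thesis
    using assms by (simp add: matrix_powr_def matrix_exp_diag powr_def)
qed

lemma diag_mult_vec:
  "(vector [vector [p, 0], vector [0, q]] :: real^2^2) *v x = vector [p * x $ 1, q * x $ 2]"
  by (simp add: vec_eq_iff forall_2 matrix_vector_mult_def sum_2)

lemma inner_vector_2: "(t::real^2) \<bullet> vector [x, y] = t $ 1 * x + t $ 2 * y"
  by (simp add: inner_vec_def sum_2)

lemma borel_measurable_vector_2[measurable (raw)]:
  fixes f g :: "'a \<Rightarrow> real"
  assumes [measurable]: "f \<in> borel_measurable M" "g \<in> borel_measurable M"
  shows "(\<lambda>x. vector [f x, g x] :: real^2) \<in> borel_measurable M"
proof -
  have "(\<lambda>x. vector [f x, g x] :: real^2) = (\<lambda>x. f x *\<^sub>R axis 1 1 + g x *\<^sub>R axis 2 1)"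
    by (simp add: fun_eq_iff vec_eq_iff forall_2 axis_def)
  then show ?thesis by simp
qed

lemma Basis_vec_2: "(Basis :: (real^2) set) = {axis 1 1, axis 2 1}"
  by (auto simp: Basis_vec_def UNIV_2)

lemma sum_Basis_vec_2: "(\<Sum>b\<in>(Basis :: (real^2) set). f b) = f (axis 1 1) + f (axis 2 1)"
  unfolding Basis_vec_2 by (simp add: axis_eq_axis)

section \<open>Poisson series with Gaussian marks\<close>

lemma gaussian_char_fun:
  assumes "prob_space M" and Z: "distributed M lborel Z (normal_density 0 \<sigma>)" and "0 < \<sigma>"
  shows "(CLINT \<omega>|M. iexp (c * Z \<omega>)) = of_real (exp (- (\<sigma> * c)\<^sup>2 / 2))"
proof -
  have [measurable]: "Z \<in> borel_measurable M"
    using distributed_measurable[OF Z] by simp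
  have "(CLINT \<omega>|M. iexp (c * Z \<omega>)) = (CLINT z|distr M lborel Z. iexp (c * z))"
    by (subst integral_distr) auto
  also have "\<dots> = (CLINT z|lborel. of_real (normal_density 0 \<sigma> z) * iexp (c * z))"
    unfolding distributed_distr_eq_density[OF Z]
    by (subst integral_density) (auto simp: scaleR_conv_of_real)
  finally show ?thesis
    using normal_density_fourier[OF \<open>0 < \<sigma>\<close>] by simp
qed

text \<open>Given the points, a linear combination of finitely many marks is normal; independence of points and
  marks turns this into an iterated integral. Restricting to finite sums avoids the
  question for which values of the points the full series converges.\<close>

lemma gaussian_average:
  fixes P Z :: "nat \<Rightarrow> 'w \<Rightarrow> real" and c :: "nat \<Rightarrow> (nat \<Rightarrow> real) \<Rightarrow> real" and H :: "(nat \<Rightarrow> real) \<Rightarrow> complex"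
  assumes "prob_space M" and "0 < \<sigma>"
    and indep_Z: "prob_space.indep_vars M (\<lambda>_. borel) Z UNIV"
    and Z: "\<And>i. distributed M lborel (Z i) (normal_density 0 \<sigma>)"
    and indep: "prob_space.indep_var M (Pi\<^sub>M UNIV (\<lambda>_. borel)) (\<lambda>\<omega> i. P i \<omega>)
                  (Pi\<^sub>M UNIV (\<lambda>_. borel)) (\<lambda>\<omega> i. Z i \<omega>)"
    and H[measurable]: "H \<in> borel_measurable (Pi\<^sub>M UNIV (\<lambda>_. borel))" and H_le: "\<And>p. cmod (H p) \<le> 1"
    and c[measurable]: "\<And>i. c i \<in> borel_measurable (Pi\<^sub>M UNIV (\<lambda>_. borel))"
  shows "(CLINT \<omega>|M. H (\<lambda>i. P i \<omega>) * iexp (\<Sum>i<n. c i (\<lambda>i. P i \<omega>) * Z i \<omega>))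
       = (CLINT \<omega>|M. H (\<lambda>i. P i \<omega>) * of_real (exp (\<Sum>i<n. - (\<sigma> * c i (\<lambda>i. P i \<omega>))\<^sup>2 / 2)))"
proof -
  interpret prob_space M by fact
  let ?S = "Pi\<^sub>M UNIV (\<lambda>_. borel) :: (nat \<Rightarrow> real) measure"
  let ?P = "\<lambda>\<omega> i. P i \<omega>" and ?Z = "\<lambda>\<omega> i. Z i \<omega>"
  have P_meas[measurable]: "?P \<in> M \<rightarrow>\<^sub>M ?S" and Z_meas[measurable]: "?Z \<in> M \<rightarrow>\<^sub>M ?S"
    and joint: "distr M ?S ?P \<Otimes>\<^sub>M distr M ?S ?Z = distr M (?S \<Otimes>\<^sub>M ?S) (\<lambda>\<omega>. (?P \<omega>, ?Z \<omega>))"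
    using indep by (auto simp: indep_var_distribution_eq)
  have Zi[measurable]: "Z i \<in> borel_measurable M" for i
    using distributed_measurable[OF Z[of i]] by simp
  interpret DP: prob_space "distr M ?S ?P" by (rule prob_space_distr[OF P_meas])
  interpret DZ: prob_space "distr M ?S ?Z" by (rule prob_space_distr[OF Z_meas])
  interpret D: pair_prob_space "distr M ?S ?P" "distr M ?S ?Z" ..
  let ?F = "\<lambda>p z. H p * iexp (\<Sum>i<n. c i p * z i)"
  have F[measurable]: "case_prod ?F \<in> borel_measurable (?S \<Otimes>\<^sub>M ?S)"
    by measurable
  have int: "integrable (distr M ?S ?P \<Otimes>\<^sub>M distr M ?S ?Z) (case_prod ?F)"
    by (rule D.P.integrable_const_bound[where B=1])
       (auto intro!: AE_I2 simp: norm_mult H_le split: prod.split)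
  have "(CLINT \<omega>|M. ?F (?P \<omega>) (?Z \<omega>)) = integral\<^sup>L (distr M (?S \<Otimes>\<^sub>M ?S) (\<lambda>\<omega>. (?P \<omega>, ?Z \<omega>))) (case_prod ?F)"
    by (subst integral_distr) auto
  also have "\<dots> = (CLINT p|distr M ?S ?P. CLINT z|distr M ?S ?Z. ?F p z)"
    unfolding joint[symmetric] by (rule D.integral_fst[OF int, symmetric])
  also have "\<dots> = (CLINT p|distr M ?S ?P. H p * of_real (exp (\<Sum>i<n. - (\<sigma> * c i p)\<^sup>2 / 2)))"
  proof (intro Bochner_Integration.integral_cong refl)
    fix p :: "nat \<Rightarrow> real"
    have "indep_vars (\<lambda>_. borel) Z {..<n}"
      using indep_Z by (rule indep_vars_subset) auto
    then have ind: "indep_vars (\<lambda>_. borel) (\<lambda>i \<omega>. iexp (c i p * Z i \<omega>)) {..<n}"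
      by (rule indep_vars_compose2[where Y="\<lambda>i z. iexp (c i p * z)"]) measurable
    have "(CLINT z|distr M ?S ?Z. ?F p z) = H p * (CLINT \<omega>|M. iexp (\<Sum>i<n. c i p * Z i \<omega>))"
      by (subst integral_distr) auto
    also have "(CLINT \<omega>|M. iexp (\<Sum>i<n. c i p * Z i \<omega>)) = (CLINT \<omega>|M. \<Prod>i<n. iexp (c i p * Z i \<omega>))"
      by (simp add: exp_sum[symmetric] sum_distrib_left)
    also have "\<dots> = (\<Prod>i<n. CLINT \<omega>|M. iexp (c i p * Z i \<omega>))"
      by (rule indep_vars_lebesgue_integral[OF _ ind])
         (auto intro!: integrable_const_bound[where B=1])
    also have "\<dots> = (\<Prod>i<n. of_real (exp (- (\<sigma> * c i p)\<^sup>2 / 2)))"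
      by (intro prod.cong refl gaussian_char_fun assms)
    also have "\<dots> = of_real (exp (\<Sum>i<n. - (\<sigma> * c i p)\<^sup>2 / 2))"
      by (simp add: exp_sum)
    finally show "(CLINT z|distr M ?S ?Z. ?F p z) = H p * of_real (exp (\<Sum>i<n. - (\<sigma> * c i p)\<^sup>2 / 2))" .
  qed
  also have "\<dots> = (CLINT \<omega>|M. H (?P \<omega>) * of_real (exp (\<Sum>i<n. - (\<sigma> * c i (?P \<omega>))\<^sup>2 / 2)))"
    by (subst integral_distr) auto
  finally show ?thesis .
qed

context stable_jumps
begin

text \<open>The marks are integrated out for the truncated series by \<open>gaussian_average\<close>. Passing to the limit on
  both sides leaves an exponential functional of the points alone.\<close>

lemma char_fun_marked_series:
  fixes P Z :: "nat \<Rightarrow> 'w \<Rightarrow> real"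
  assumes "prob_space M" and "0 < \<sigma>"
    and P[measurable]: "\<And>i. P i \<in> borel_measurable M"
    and ppp: "poisson_point_process M \<Lambda> (\<lambda>\<omega>. sum_of_diracs (\<lambda>i. P i \<omega>))"
    and indep_Z: "prob_space.indep_vars M (\<lambda>_. borel) Z UNIV"
    and Z: "\<And>i. distributed M lborel (Z i) (normal_density 0 \<sigma>)"
    and indep: "prob_space.indep_var M (Pi\<^sub>M UNIV (\<lambda>_. borel)) (\<lambda>\<omega> i. P i \<omega>)
                  (Pi\<^sub>M UNIV (\<lambda>_. borel)) (\<lambda>\<omega> i. Z i \<omega>)"
    and summ_P: "AE \<omega> in M. summable (\<lambda>i. (P i \<omega>)\<^sup>2)"
    and summ_Z: "AE \<omega> in M. summable (\<lambda>i. P i \<omega> powr (3/2) * Z i \<omega>)"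
  shows "(CLINT \<omega>|M. iexp (s * (\<Sum>i. (P i \<omega>)\<^sup>2) + u * (\<Sum>i. P i \<omega> powr (3/2) * Z i \<omega>)))
           = exp (levy_exponent s ((\<sigma> * u)\<^sup>2 / 2))"
proof -
  interpret prob_space M by fact
  have [measurable]: "Z i \<in> borel_measurable M" for i
    using distributed_measurable[OF Z[of i]] by simp
  let ?b = "(\<sigma> * u)\<^sup>2 / 2"
  let ?H = "\<lambda>p. iexp (s * (\<Sum>i. (p i)\<^sup>2)) :: complex"
  let ?c = "\<lambda>i p. u * p i powr (3/2)"
  let ?E = "\<lambda>\<omega>. \<Sum>i. jump_exponent s ?b (P i \<omega>)"
  have P_pos: "AE \<omega> in M. \<forall>i. P i \<omega> \<notin> {..0}"
    by (rule poisson_point_process_AE_notin[OF \<open>prob_space M\<close> ppp]) (auto simp: emeasure_\<Lambda>_atMost_0)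
  \<comment> \<open>The points tend to \<open>0\<close>, so that cubes are eventually below squares.\<close>
  have summ_P3: "AE \<omega> in M. summable (\<lambda>i. (P i \<omega>) ^ 3)"
    using summ_P P_pos
  proof eventually_elim
    case (elim \<omega>)
    then have "(\<lambda>i. (P i \<omega>)\<^sup>2) \<longlonglongrightarrow> 0" by (intro summable_LIMSEQ_zero)
    then have "\<forall>\<^sub>F i in sequentially. (P i \<omega>)\<^sup>2 < 1" by (rule order_tendstoD) simp
    then have "\<forall>\<^sub>F i in sequentially. norm (P i \<omega> ^ 3) \<le> (P i \<omega>)\<^sup>2"
    proof eventually_elim
      fix i assume "(P i \<omega>)\<^sup>2 < 1"
      then have "P i \<omega> \<le> 1" by (simp add: abs_square_less_1)
      moreover have "0 < P i \<omega>" using elim(2) by (simp add: not_le)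
      ultimately show "norm (P i \<omega> ^ 3) \<le> (P i \<omega>)\<^sup>2" by (simp add: power_decreasing)
    qed
    then show ?case using elim(1) by (rule summable_comparison_test_ev)
  qed
  let ?L = "\<lambda>n. CLINT \<omega>|M. ?H (\<lambda>i. P i \<omega>) * iexp (\<Sum>i<n. ?c i (\<lambda>i. P i \<omega>) * Z i \<omega>)"
  let ?R = "\<lambda>n. CLINT \<omega>|M. ?H (\<lambda>i. P i \<omega>) * of_real (exp (\<Sum>i<n. - (\<sigma> * ?c i (\<lambda>i. P i \<omega>))\<^sup>2 / 2))"
  have LR: "?L n = ?R n" for n
  proof (rule gaussian_average[OF \<open>prob_space M\<close> \<open>0 < \<sigma>\<close> indep_Z Z indep])
    show "?H \<in> borel_measurable (Pi\<^sub>M UNIV (\<lambda>_. borel))" by measurable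
    show "?c i \<in> borel_measurable (Pi\<^sub>M UNIV (\<lambda>_. borel))" for i by measurable
  qed simp
  have L: "?L \<longlonglongrightarrow> (CLINT \<omega>|M. iexp (s * (\<Sum>i. (P i \<omega>)\<^sup>2) + u * (\<Sum>i. P i \<omega> powr (3/2) * Z i \<omega>)))"
  proof (rule integral_dominated_convergence[where w="\<lambda>_. 1"])
    show "AE \<omega> in M. (\<lambda>n. ?H (\<lambda>i. P i \<omega>) * iexp (\<Sum>i<n. ?c i (\<lambda>i. P i \<omega>) * Z i \<omega>))
            \<longlonglongrightarrow> iexp (s * (\<Sum>i. (P i \<omega>)\<^sup>2) + u * (\<Sum>i. P i \<omega> powr (3/2) * Z i \<omega>))"
      using summ_Z
    proof eventually_elim
      case (elim \<omega>)
      have "(\<lambda>n. \<Sum>i<n. ?c i (\<lambda>i. P i \<omega>) * Z i \<omega>) \<longlonglongrightarrow> u * (\<Sum>i. P i \<omega> powr (3/2) * Z i \<omega>)"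
        using tendsto_mult_left[OF summable_LIMSEQ[OF elim], of u] by (simp add: sum_distrib_left mult.assoc)
      then have "(\<lambda>n. ?H (\<lambda>i. P i \<omega>) * iexp (\<Sum>i<n. ?c i (\<lambda>i. P i \<omega>) * Z i \<omega>))
          \<longlonglongrightarrow> ?H (\<lambda>i. P i \<omega>) * iexp (u * (\<Sum>i. P i \<omega> powr (3/2) * Z i \<omega>))"
        by (intro tendsto_intros)
      then show ?case by (simp add: exp_add distrib_left)
    qed
    show "AE \<omega> in M. norm (?H (\<lambda>i. P i \<omega>) * iexp (\<Sum>i<n. ?c i (\<lambda>i. P i \<omega>) * Z i \<omega>)) \<le> 1" for n
      by (simp add: norm_mult)
  qed auto
  have R: "?R \<longlonglongrightarrow> (CLINT \<omega>|M. exp (?E \<omega>))"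
  proof (rule integral_dominated_convergence[where w="\<lambda>_. 1"])
    show "AE \<omega> in M. (\<lambda>n. ?H (\<lambda>i. P i \<omega>) * of_real (exp (\<Sum>i<n. - (\<sigma> * ?c i (\<lambda>i. P i \<omega>))\<^sup>2 / 2)))
            \<longlonglongrightarrow> exp (?E \<omega>)"
      using summ_P summ_P3 P_pos
    proof eventually_elim
      case (elim \<omega>)
      have pos: "0 < P i \<omega>" for i using elim(3) by (simp add: not_le)
      have sq: "- (\<sigma> * ?c i (\<lambda>i. P i \<omega>))\<^sup>2 / 2 = - (?b * P i \<omega> ^ 3)" for i
      proof -
        have "(P i \<omega> powr (3/2))\<^sup>2 = P i \<omega> ^ 3"
          using pos[of i] powr_powr[of "P i \<omega>" "3/2" 2] by (simp add: powr_numeral)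
        then show ?thesis by (simp add: power_mult_distrib)
      qed
      have s1: "(\<lambda>i. - (?b * P i \<omega> ^ 3)) sums (- (?b * (\<Sum>i. P i \<omega> ^ 3)))"
        by (intro sums_minus sums_mult summable_sums elim)
      have s2: "(\<lambda>i. s * (P i \<omega>)\<^sup>2) sums (s * (\<Sum>i. (P i \<omega>)\<^sup>2))"
        by (intro sums_mult summable_sums elim)
      have "(\<lambda>i. jump_exponent s ?b (P i \<omega>)) sums Complex (- (?b * (\<Sum>i. P i \<omega> ^ 3))) (s * (\<Sum>i. (P i \<omega>)\<^sup>2))"
        unfolding sums_complex_iff using s1 s2 pos by (simp add: jump_exponent_def max_def less_imp_le)
      then have E: "?E \<omega> = Complex (- (?b * (\<Sum>i. P i \<omega> ^ 3))) (s * (\<Sum>i. (P i \<omega>)\<^sup>2))"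
        by (rule sums_unique[symmetric])
      have lim: "(\<lambda>n. ?H (\<lambda>i. P i \<omega>) * of_real (exp (\<Sum>i<n. - (?b * P i \<omega> ^ 3))))
          \<longlonglongrightarrow> ?H (\<lambda>i. P i \<omega>) * of_real (exp (- (?b * (\<Sum>i. P i \<omega> ^ 3))))"
        using s1 by (intro tendsto_intros) (simp add: sums_def)
      have eq: "?H (\<lambda>i. P i \<omega>) * of_real (exp (- (?b * (\<Sum>i. P i \<omega> ^ 3)))) = exp (?E \<omega>)"
        unfolding E Complex_eq by (simp add: exp_add[symmetric] exp_of_real[symmetric])
      show ?case unfolding sq using lim unfolding eq .
    qed
    show "AE \<omega> in M. norm (?H (\<lambda>i. P i \<omega>) * of_real (exp (\<Sum>i<n. - (\<sigma> * ?c i (\<lambda>i. P i \<omega>))\<^sup>2 / 2))) \<le> 1" for n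
      by (intro AE_I2) (auto simp: norm_mult intro!: sum_nonpos)
  qed auto
  have "(CLINT \<omega>|M. exp (?E \<omega>)) = exp (CLINT y|\<Lambda>. exp (jump_exponent s ?b y) - 1)"
  proof (rule poisson_exponential_formula[OF \<open>prob_space M\<close> P ppp sets_\<Lambda> continuous_on_jump_exponent])
    let ?C = "\<bar>s\<bar> + ?b"
    show "jump_exponent s ?b y = 0" if "y \<le> 0" for y
      using that by (simp add: jump_exponent_def Complex_eq)
    show "Re (jump_exponent s ?b y) \<le> 0" for y
      by (rule Re_jump_exponent_le_0) simp
    show "cmod (jump_exponent s ?b y) \<le> jump_bound ?C y" for y
      by (rule cmod_jump_exponent_le) auto
    show "mono (jump_bound ?C)"
      by (rule mono_jump_bound) simp
    show "integrable \<Lambda> (\<lambda>y. min 1 (jump_bound ?C y))"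
      by (rule integrable_min_jump_bound) simp
    show "AE \<omega> in M. summable (\<lambda>i. jump_bound ?C (P i \<omega>))"
      using summ_P summ_P3 P_pos
    proof eventually_elim
      case (elim \<omega>)
      have "0 < P i \<omega>" for i using elim(3) by (simp add: not_le)
      then have "jump_bound ?C (P i \<omega>) = ?C * ((P i \<omega>)\<^sup>2 + P i \<omega> ^ 3)" for i
        by (simp add: jump_bound_def max_def less_imp_le)
      then show ?case
        using summable_mult[OF summable_add[OF elim(1,2)], of ?C] by simp
    qed
  qed (rule emeasure_\<Lambda>_atLeast)
  then show ?thesis
    using LIMSEQ_unique[OF L R[folded LR]] by (simp add: levy_exponent_def)
qed

end

section \<open>Operator stability\<close>

text \<open>A distribution in the plane whose characteristic function is given by the exponent of the previous
  section. The second argument is quadratic in \<open>t\<close> because it is a conditional variance.\<close>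

locale stable_char_fun = stable_jumps +
  fixes \<nu> :: "(real^2) measure" and k1 k2 :: real
  assumes prob_\<nu>: "prob_space \<nu>" and sets_\<nu>[simp, measurable_cong]: "sets \<nu> = sets borel"
    and k1: "0 < k1" and k2: "0 < k2"
    and char_fun_\<nu>: "\<And>t. char_fun \<nu> t = exp (levy_exponent (k1 * t $ 1) (k2 * (t $ 2)\<^sup>2))"
begin

abbreviation log_char_fun :: "real^2 \<Rightarrow> complex" where
  "log_char_fun t \<equiv> levy_exponent (k1 * t $ 1) (k2 * (t $ 2)\<^sup>2)"

abbreviation exponent_matrix :: "real^2^2" where
  "exponent_matrix \<equiv> vector [vector [2 / \<alpha>, 0], vector [0, 3 / (2 * \<alpha>)]]"

lemma continuous_on_log_char_fun: "continuous_on UNIV log_char_fun"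
proof (rule continuous_at_imp_continuous_on, intro ballI continuous_at_sequentiallyI)
  fix t :: "real^2" and T :: "nat \<Rightarrow> real^2"
  assume T: "T \<longlonglongrightarrow> t"
  show "(\<lambda>n. log_char_fun (T n)) \<longlonglongrightarrow> log_char_fun t"
    using k2 by (intro tendsto_levy_exponent tendsto_intros T) auto
qed

lemma rapidly_decaying_char_fun: "rapidly_decaying (char_fun \<nu>)"
proof -
  obtain c where c: "0 < c"
    "\<And>a b. 0 \<le> b \<Longrightarrow> c * (\<bar>a\<bar> powr (\<alpha> / 2) + b powr (\<alpha> / 3)) \<le> - Re (levy_exponent a b)"
    using levy_exponent_lower_bound by blast
  define d where "d = c * min (k1 powr (\<alpha> / 2)) (k2 powr (\<alpha> / 3))"
  \<comment> \<open>In terms of the second coordinate itself, the power \<open>\<alpha>/3\<close> of its square has degree \<open>2\<alpha>/3\<close>.\<close>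
  define \<beta> :: "real^2 \<Rightarrow> real" where "\<beta> b = (if b = axis 1 1 then \<alpha> / 2 else 2 * \<alpha> / 3)" for b
  show ?thesis
  proof (rule rapidly_decaying_of_stretched_exp_bound)
    show "char_fun \<nu> \<in> borel_measurable borel"
      by (rule borel_measurable_char_fun[OF prob_\<nu> sets_\<nu>])
    show "0 < d" using c k1 k2 by (simp add: d_def)
    show "0 < \<beta> b" for b using \<alpha>_pos by (simp add: \<beta>_def)
    fix w :: "real^2"
    have sum: "(\<Sum>b\<in>Basis. \<bar>w \<bullet> b\<bar> powr \<beta> b) = \<bar>w $ 1\<bar> powr (\<alpha> / 2) + \<bar>w $ 2\<bar> powr (2 * \<alpha> / 3)"
      by (simp add: sum_Basis_vec_2 \<beta>_def inner_axis axis_eq_axis)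
    have sq: "\<bar>w $ 2\<bar> powr (2 * \<alpha> / 3) = (w $ 2)\<^sup>2 powr (\<alpha> / 3)"
      using powr_powr[of "\<bar>w $ 2\<bar>" 2 "\<alpha> / 3"] by (simp add: powr_numeral)
    have "d * (\<bar>w $ 1\<bar> powr (\<alpha> / 2) + \<bar>w $ 2\<bar> powr (2 * \<alpha> / 3))
        \<le> c * (k1 powr (\<alpha> / 2) * \<bar>w $ 1\<bar> powr (\<alpha> / 2) + k2 powr (\<alpha> / 3) * (w $ 2)\<^sup>2 powr (\<alpha> / 3))"
    proof -
      let ?m = "min (k1 powr (\<alpha> / 2)) (k2 powr (\<alpha> / 3))"
      have "?m * \<bar>w $ 1\<bar> powr (\<alpha> / 2) + ?m * \<bar>w $ 2\<bar> powr (2 * \<alpha> / 3)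
          \<le> k1 powr (\<alpha> / 2) * \<bar>w $ 1\<bar> powr (\<alpha> / 2) + k2 powr (\<alpha> / 3) * (w $ 2)\<^sup>2 powr (\<alpha> / 3)"
        unfolding sq by (intro add_mono mult_right_mono) auto
      from mult_left_mono[OF this less_imp_le[OF c(1)]] show ?thesis
        unfolding d_def by (simp add: distrib_left mult.assoc)
    qed
    also have "\<dots> = c * (\<bar>k1 * w $ 1\<bar> powr (\<alpha> / 2) + (k2 * (w $ 2)\<^sup>2) powr (\<alpha> / 3))"
      using k1 k2 by (simp add: abs_mult powr_mult)
    also have "\<dots> \<le> - Re (log_char_fun w)"
      using k2 by (intro c(2)) simp
    finally show "cmod (char_fun \<nu> w) \<le> exp (- (d * (\<Sum>b\<in>Basis. \<bar>w \<bullet> b\<bar> powr \<beta> b)))"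
      unfolding sum by (simp add: char_fun_\<nu>)
  qed
qed

text \<open>The diagonal map rescales the arguments of the characteristic function. With \<open>l = a powr (1 / \<alpha>)\<close>
  its entries are \<open>l\<^sup>2\<close> and a square root of \<open>l\<^sup>3\<close>; the second argument of the exponent is quadratic,
  so that \<open>levy_exponent_scale\<close> applies.\<close>

lemma
  assumes "0 < a"
  defines "\<rho> \<equiv> distr \<nu> borel (\<lambda>x. matrix_powr a exponent_matrix *v x + 0)"
  shows prob_space_scaled: "prob_space \<rho>" and sets_scaled: "sets \<rho> = sets borel"
    and char_fun_scaled: "char_fun \<rho> t = exp (of_real a * log_char_fun t)"
proof -
  interpret prob_space \<nu> by (rule prob_\<nu>)
  \<comment> \<open>The scale that turns \<open>l powr \<alpha>\<close> into \<open>a\<close>.\<close>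
  let ?l = "a powr (1 / \<alpha>)"
  have l: "0 < ?l" "?l\<^sup>2 = a powr (2 / \<alpha>)" "?l ^ 3 = (a powr (3 / (2 * \<alpha>)))\<^sup>2" "?l powr \<alpha> = a"
    using assms(1) \<alpha>_pos by (simp_all flip: powr_numeral add: powr_powr)
  have map: "matrix_powr a exponent_matrix *v x + 0 = vector [a powr (2 / \<alpha>) * x $ 1, a powr (3 / (2 * \<alpha>)) * x $ 2]" for x
    by (simp only: matrix_powr_diag[OF assms(1)] diag_mult_vec add_0_right)
  have meas: "(\<lambda>x. matrix_powr a exponent_matrix *v x + 0) \<in> \<nu> \<rightarrow>\<^sub>M borel"
    unfolding map by measurable
  show "prob_space \<rho>"
    unfolding \<rho>_def by (rule prob_space_distr[OF meas])
  show "sets \<rho> = sets borel" by (simp add: \<rho>_def)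
  have "char_fun \<rho> t = (CLINT x|\<nu>. iexp (t \<bullet> (matrix_powr a exponent_matrix *v x + 0)))"
    unfolding char_fun_def \<rho>_def by (subst integral_distr[OF meas]) auto
  also have "\<dots> = char_fun \<nu> (vector [a powr (2 / \<alpha>) * t $ 1, a powr (3 / (2 * \<alpha>)) * t $ 2])"
    unfolding map char_fun_def by (simp add: inner_vec_def sum_2 mult_ac)
  also have "\<dots> = exp (levy_exponent ((k1 * t $ 1) * ?l\<^sup>2) (k2 * (t $ 2)\<^sup>2 * ?l ^ 3))"
    unfolding char_fun_\<nu> l by (simp add: power_mult_distrib mult_ac)
  also have "\<dots> = exp (of_real a * log_char_fun t)"
    by (simp only: levy_exponent_scale[OF l(1)] l(4) scaleR_conv_of_real)
  finally show "char_fun \<rho> t = exp (of_real a * log_char_fun t)" .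
qed

lemma infinitely_divisible: "infinitely_divisible \<nu>"
  unfolding infinitely_divisible_def
proof (intro allI impI)
  fix n :: nat assume n: "0 < n"
  let ?\<rho> = "distr \<nu> borel (\<lambda>x. matrix_powr (1 / real n) exponent_matrix *v x + 0)"
  have a: "0 < 1 / real n" using n by simp
  note \<rho> = prob_space_scaled[OF a] sets_scaled[OF a]
  have "convolution_power ?\<rho> n = \<nu>"
  proof (rule char_fun_unique)
    show "char_fun (convolution_power ?\<rho> n) t = char_fun \<nu> t" for t
    proof -
      have "char_fun (convolution_power ?\<rho> n) t = exp (of_real (1 / real n) * log_char_fun t) ^ n"
        by (simp only: char_fun_convolution_power[OF \<rho>] char_fun_scaled[OF a])
      also have "\<dots> = exp (log_char_fun t)"
        using n by (simp add: exp_of_nat_mult[symmetric])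
      finally show ?thesis by (simp add: char_fun_\<nu>)
    qed
  qed (use prob_\<nu> sets_\<nu> prob_space_convolution_power[OF \<rho>] sets_convolution_power[OF \<rho>]
        rapidly_decaying_integrable[OF rapidly_decaying_char_fun] in auto)
  then show "\<exists>\<rho>. prob_space \<rho> \<and> sets \<rho> = sets borel \<and> \<nu> = convolution_power \<rho> n"
    using \<rho> by metis
qed

lemma full: "full_distribution \<nu>"
proof -
  let ?f = "\<lambda>y. ennreal (Re (inv_fourier (char_fun \<nu>) y))"
  have dens: "\<nu> = density lborel ?f"
    by (rule density_inv_fourier_char_fun[OF prob_\<nu> sets_\<nu>
        rapidly_decaying_integrable[OF rapidly_decaying_char_fun]])
  have [measurable]: "char_fun \<nu> \<in> borel_measurable borel"
    by (rule rapidly_decaying_measurable[OF rapidly_decaying_char_fun])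
  have "full_distribution (density lborel ?f)"
    by (rule full_distribution_density_lborel) (use prob_\<nu> dens in \<open>metis, measurable\<close>)
  then show ?thesis by (subst dens)
qed

lemma operator_stable_exponent: "operator_stable_exponent \<nu> exponent_matrix"
  unfolding operator_stable_exponent_def
proof (intro conjI allI impI)
  fix a :: real assume a: "0 < a"
  let ?\<rho> = "distr \<nu> borel (\<lambda>x. matrix_powr a exponent_matrix *v x + 0)"
  have "is_real_convolution_power \<nu> a ?\<rho>"
    unfolding is_real_convolution_power_def
    by (intro conjI prob_space_scaled[OF a] sets_scaled[OF a] exI[of _ log_char_fun] allI
        continuous_on_log_char_fun char_fun_scaled[OF a] char_fun_\<nu>) (simp add: levy_exponent_0)
  then show "\<exists>b. is_real_convolution_power \<nu> a (distr \<nu> borel (\<lambda>x. matrix_powr a exponent_matrix *v x + b))"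
    by (rule exI)
qed (fact prob_\<nu> sets_\<nu> full infinitely_divisible)+

end

theorem proposition5p3:
  fixes \<alpha> \<mu>\<^sub>A \<sigma>\<^sub>A \<theta> :: real
    and M :: "'w measure" and P Z :: "nat \<Rightarrow> 'w \<Rightarrow> real"
    and N :: "'v measure" and V1 V2 :: "'v \<Rightarrow> real"
    and \<nu> :: "(real^2) measure"
  assumes "1 < \<alpha>" "\<alpha> < 2"
    and "0 < \<mu>\<^sub>A" "\<mu>\<^sub>A < 1"
    and "0 < \<sigma>\<^sub>A"
    and "\<theta> = 1 - \<mu>\<^sub>A powr \<alpha>"
    and "prob_space M"
    and "\<And>i. P i \<in> borel_measurable M"
    and "poisson_point_process M
           (density lborel (\<lambda>y. ennreal (\<theta> * \<alpha> * y powr (- \<alpha> - 1)) * indicator {0<..} y))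
           (\<lambda>\<omega>. sum_of_diracs (\<lambda>i. P i \<omega>))"
    and "AE \<omega> in M. decseq (\<lambda>i. P i \<omega>)"
    and "prob_space.indep_vars M (\<lambda>_. borel) Z UNIV"
    and "\<And>i. distributed M lborel (Z i) (normal_density 0 \<sigma>\<^sub>A)"
    and "prob_space.indep_var M
           (Pi\<^sub>M UNIV (\<lambda>_. borel)) (\<lambda>\<omega> i. P i \<omega>) (Pi\<^sub>M UNIV (\<lambda>_. borel)) (\<lambda>\<omega> i. Z i \<omega>)"
    and "AE \<omega> in M. summable (\<lambda>i. (P i \<omega>)\<^sup>2)"
    and "AE \<omega> in M. summable (\<lambda>i. P i \<omega> powr (3/2) * Z i \<omega>)"
    and "prob_space N"
    and "V1 \<in> borel_measurable N" "V2 \<in> borel_measurable N"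
    and "\<nu> = distr N borel (\<lambda>\<omega>. vector [V1 \<omega>, V2 \<omega>])"
    and "\<nu> = distr M borel (\<lambda>\<omega>. vector
           [1 / (1 - \<mu>\<^sub>A\<^sup>2) * (\<Sum>i. (P i \<omega>)\<^sup>2),
            1 / (1 - \<mu>\<^sub>A ^ 3) powr (1/2) * (\<Sum>i. P i \<omega> powr (3/2) * Z i \<omega>)])"
  shows "operator_stable \<nu> \<and>
    operator_stable_exponent \<nu> (vector [vector [2 / \<alpha>, 0], vector [0, 3 / (2 * \<alpha>)]]) \<and>
    full_distribution \<nu> \<and>
    infinitely_divisible \<nu> \<and>
    (\<exists>f. (\<forall>x. 0 \<le> f x) \<and> \<nu> = density lborel (\<lambda>x. ennreal (f x)) \<and>
         infinitely_differentiable f \<and>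
         (\<forall>is. is \<noteq> [] \<longrightarrow> (iterated_partial_deriv is f \<longlongrightarrow> 0) at_infinity))"
proof -
  have "\<mu>\<^sub>A powr \<alpha> < 1"
    using powr_less_mono2[of \<alpha> \<mu>\<^sub>A 1] assms(1,3,4) by simp
  then interpret stable_jumps "\<theta> * \<alpha>" \<alpha>
    using assms(1,2,6) by unfold_locales auto
  interpret M: prob_space M by fact
  let ?A = "1 / (1 - \<mu>\<^sub>A\<^sup>2)" and ?B = "1 / (1 - \<mu>\<^sub>A ^ 3) powr (1/2)"
  have pow: "\<mu>\<^sub>A\<^sup>2 < 1" "\<mu>\<^sub>A ^ 3 < 1"
    using assms(3,4) by (simp_all add: power_less_one_iff)
  then have A: "0 < ?A" and B: "0 < ?B" by simp_all
  note [measurable] = assms(8)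
  have [measurable]: "Z i \<in> borel_measurable M" for i
    using distributed_measurable[OF assms(12)[of i]] by simp
  have meas: "(\<lambda>\<omega>. vector [?A * (\<Sum>i. (P i \<omega>)\<^sup>2), ?B * (\<Sum>i. P i \<omega> powr (3/2) * Z i \<omega>)] :: real^2) \<in> borel_measurable M"
    by measurable
  have \<Lambda>: "density lborel (\<lambda>y. ennreal (\<theta> * \<alpha> * y powr (- \<alpha> - 1)) * indicator {0<..} y) = \<Lambda>"
    by (simp add: \<Lambda>_def)
  interpret stable_char_fun "\<theta> * \<alpha>" \<alpha> \<nu> ?A "(\<sigma>\<^sub>A * ?B)\<^sup>2 / 2"
  proof (intro stable_char_fun.intro[OF stable_jumps_axioms] stable_char_fun_axioms.intro)
    show "prob_space \<nu>" unfolding assms(20) by (rule M.prob_space_distr[OF meas])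
    show "sets \<nu> = sets borel" unfolding assms(20) by simp
    show "0 < ?A" by (rule A)
    show "0 < (\<sigma>\<^sub>A * ?B)\<^sup>2 / 2" using B assms(5) by simp
    fix t :: "real^2"
    have "char_fun \<nu> t = (CLINT \<omega>|M. iexp ((?A * t $ 1) * (\<Sum>i. (P i \<omega>)\<^sup>2)
              + (?B * t $ 2) * (\<Sum>i. P i \<omega> powr (3/2) * Z i \<omega>)))"
      unfolding assms(20) char_fun_def
      by (subst integral_distr[OF meas]) (simp_all add: inner_vector_2 mult_ac)
    also have "\<dots> = exp (levy_exponent (?A * t $ 1) ((\<sigma>\<^sub>A * (?B * t $ 2))\<^sup>2 / 2))"
      by (rule char_fun_marked_series[OF assms(7,5,8,9)[unfolded \<Lambda>] assms(11-15)])
    also have "(\<sigma>\<^sub>A * (?B * t $ 2))\<^sup>2 / 2 = (\<sigma>\<^sub>A * ?B)\<^sup>2 / 2 * (t $ 2)\<^sup>2"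
      by (simp add: power_mult_distrib power_divide)
    finally show "char_fun \<nu> t = exp (levy_exponent (?A * t $ 1) ((\<sigma>\<^sub>A * ?B)\<^sup>2 / 2 * (t $ 2)\<^sup>2))" .
  qed
  show ?thesis
    using smooth_density_of_rapidly_decaying_char_fun[OF prob_\<nu> sets_\<nu> rapidly_decaying_char_fun]
      operator_stable_exponent full infinitely_divisible unfolding operator_stable_def by blast
qed

end
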